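(* Let $S$ and $A$ be finite sets, $\mathcal{X}:=S\times A$, let $p(r,s'\mid s,a)$ be the transition kernel of a Markov decision process on $S\times A$ with real-valued rewards, and let $\gamma\in(0,1)$ be the discount factor. For $(s,a)\in\mathcal{X}$ let $r(s,a)$ denote the random immediate reward obtained when action $a$ is taken in state $s$, and suppose that $E[r(s,a)^2]<\infty$ for every $(s,a)\in\mathcal{X}$. Let $(s_t,a_t,r_t)_{t=0}^\infty$ be the state-action-reward process of the Markov decision process, let $Q_0:\mathcal{X}\to\mathbb{R}$ be an initial function, and define for $t\ge 0$ and $(s,a)\in\mathcal{X}$ $$Q_{t+1}(s,a)=(1-\alpha(s,a,s_t,a_t,t))\,Q_t(s,a)+\alpha(s,a,s_t,a_t,t)\Big[r_t(s_t,a_t)+\gamma\max_{b\in A}Q_t(s_{t+1},b)\Big],$$ where $\alpha(s,a,s_t,a_t,t)=c_t$ if $(s_t,a_t)=(s,a)$ and $\alpha(s,a,s_t,a_t,t)=0$ otherwise, where $(c_t)_{t\ge0}$ is a real sequence with $c_t\in[0,1]$ for all $t$, $\sum_{t=0}^\infty c_t=\infty$ and $\sum_{t=0}^\infty c_t^2<\infty$, and where for every $(s,a)\in\mathcal{X}$, almost surely, $$\sum_{t=0}^\infty\alpha(s,a,s_t,a_t,t)=\infty,\qquad \sum_{t=0}^\infty\alpha(s,a,s_t,a_t,t)^2<\infty .$$ Then, with probability $1$, $$\|Q_t-Q^*\|_W\to 0\quad\text{as }t\to\infty,$$ where $Q^*$ is the optimal state action value function and $\|f\|_W:=\max_{x\in\mathcal{X}}|f(x)|$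 on the space $W$ of functions $f:\mathcal{X}\to\mathbb{R}$.
   Context: The transition kernel $p$ assigns to each $(s,a)\in S\times A$ a probability measure $p(\cdot\mid s,a)$ on $\mathbb{R}\times S$, the joint law of the immediate reward $r\in\mathbb{R}$ and the next state $s'\in S$ when action $a$ is taken in state $s$; the law of $r(s,a)$ is its reward marginal. In the process $(s_t,a_t,r_t)_{t\ge0}$, with values in $S$, $A$, $\mathbb{R}$, given the history up to and including $(s_t,a_t)$ the pair $(r_t,s_{t+1})$ has law $p(\cdot\mid s_t,a_t)$; $r_t(s_t,a_t)$ denotes $r_t$. A strategy (policy) is a map $\pi:S\to\mathcal{P}(A)$, where $\mathcal{P}(A)$ is the set of probability measures on $A$; $\Pi$ is the set of all policies. The state action value function of $\pi$ is $Q^\pi(s,a)=E\big[\sum_{t=0}^\infty\gamma^t r_t\mid s_0=s,a_0=a\big]$, where $(r_t,s_{t+1})\sim p(\cdot\mid s_t,a_t)$ for all $t\ge 0$ and $a_t\sim\pi(\cdot\mid s_t)$ for $t\ge1$. The state value function is $V^\pi(s)=\sum_{a\in A}\pi(a\mid s)Q^\pi(s,a)$. The optimal policy $\pi^*$ is $\operatorname{argmax}_{\pi\in\Pi}V^\pi(s_0)$, and $Q^*:=Q^{\pi^*}$; the optimal policy is greedy with respect to $Q^*$, i.e. for every $s\in S$, $\pi^*(\cdot\mid s)$ puts mass $1$ on an action maximizing $Q^*(s,\cdot)$. Equivalently, $Q^*$ is the fixed point of the operator $\mathcal{T}$ on $W$ given by $\mathcal{T}q(s,a)=\int_{\mathbb{R}}\sum_{s'\in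 S}\big[r+\gamma\max_{b\in A}q(s',b)\big]\,p(dr,s'\mid s,a)$. *)

theory Defs
  imports "HOL-Probability.Probability"
begin

section \<open>Markov decision processes with random real rewards\<close>

definition transition_kernel :: "('s::finite \<Rightarrow> 'a::finite \<Rightarrow> (real \<times> 's) measure) \<Rightarrow> bool" where
  "transition_kernel p \<longleftrightarrow>
     (\<forall>s a. p s a \<in> space (prob_algebra (borel \<Otimes>\<^sub>M count_space UNIV)))"

definition reward_law :: "('s \<Rightarrow> 'a \<Rightarrow> (real \<times> 's) measure) \<Rightarrow> 's \<Rightarrow> 'a \<Rightarrow> real measure" where
  "reward_law p s a = distr (p s a) borel fst"

text \<open>
  \<^term>\<open>history_algebra\<close> is generated by the history \<open>(s\<^sub>0, a\<^sub>0, r\<^sub>0, \<dots>, s\<^sub>t\<^sub>-\<^sub>1, a\<^sub>t\<^sub>-\<^sub>1, r\<^sub>t\<^sub>-\<^sub>1, s\<^sub>t, a\<^sub>t)\<close>;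
  the reward \<open>r\<^sub>t\<close> is not part of it.  In an MDP process the way in which the actions are chosen is
  left unrestricted (they may depend on the whole past), and so is the law of \<open>s\<^sub>0\<close>.
\<close>

definition history_algebra ::
  "'w measure \<Rightarrow> (nat \<Rightarrow> 'w \<Rightarrow> 's) \<Rightarrow> (nat \<Rightarrow> 'w \<Rightarrow> 'a) \<Rightarrow> (nat \<Rightarrow> 'w \<Rightarrow> real) \<Rightarrow> nat \<Rightarrow> 'w measure" where
  "history_algebra M s a r t =
     vimage_algebra (space M)
       (\<lambda>\<omega>. (\<lambda>i\<in>{..<t}. (s i \<omega>, a i \<omega>, r i \<omega>), s t \<omega>, a t \<omega>))
       ((\<Pi>\<^sub>M i\<in>{..<t}. count_space UNIV \<Otimes>\<^sub>M count_space UNIV \<Otimes>\<^sub>M borel)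
          \<Otimes>\<^sub>M count_space UNIV \<Otimes>\<^sub>M count_space UNIV)"

definition mdp_process ::
  "'w measure \<Rightarrow> ('s::finite \<Rightarrow> 'a::finite \<Rightarrow> (real \<times> 's) measure) \<Rightarrow>
   (nat \<Rightarrow> 'w \<Rightarrow> 's) \<Rightarrow> (nat \<Rightarrow> 'w \<Rightarrow> 'a) \<Rightarrow> (nat \<Rightarrow> 'w \<Rightarrow> real) \<Rightarrow> bool" where
  "mdp_process M p s a r \<longleftrightarrow>
     prob_space M \<and>
     (\<forall>t. s t \<in> measurable M (count_space UNIV)) \<and>
     (\<forall>t. a t \<in> measurable M (count_space UNIV)) \<and>
     (\<forall>t. r t \<in> borel_measurable M) \<and>
     (\<forall>t. \<forall>B \<in> sets (borel \<Otimes>\<^sub>M count_space UNIV).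
        AE \<omega> in M.
          real_cond_exp M (history_algebra M s a r t) (\<lambda>\<omega>. indicator B (r t \<omega>, s (Suc t) \<omega>)) \<omega>
          = measure (p (s t \<omega>) (a t \<omega>)) B)"


section \<open>Policies and value functions\<close>

type_synonym ('s, 'a) policy = "'s \<Rightarrow> 'a pmf"

abbreviation step_space :: "(real \<times> 's \<times> 'a) measure" where
  "step_space \<equiv> borel \<Otimes>\<^sub>M count_space UNIV \<Otimes>\<^sub>M count_space UNIV"

text \<open>
  The canonical process under a policy started in \<open>(s, a)\<close> is built with the Ionescu-Tulcea theorem.
  Since \<open>r\<^sub>t\<close> and \<open>s\<^sub>t\<^sub>+\<^sub>1\<close> are drawn jointly, the coordinates of a trajectory \<open>\<omega>\<close> are
  \<open>\<omega> 0 = (0, s\<^sub>0, a\<^sub>0)\<close>, whose first component is a dummy, and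
  \<open>\<omega> (t + 1) = (r\<^sub>t, s\<^sub>t\<^sub>+\<^sub>1, a\<^sub>t\<^sub>+\<^sub>1)\<close>.
\<close>

definition step_kernel ::
  "('s::finite \<Rightarrow> 'a::finite \<Rightarrow> (real \<times> 's) measure) \<Rightarrow> ('s, 'a) policy \<Rightarrow>
   real \<times> 's \<times> 'a \<Rightarrow> (real \<times> 's \<times> 'a) measure" where
  "step_kernel p \<pi> = (\<lambda>(_, s, a).
     p s a \<bind> (\<lambda>(r, s'). distr (measure_pmf (\<pi> s')) step_space (\<lambda>a'. (r, s', a'))))"

definition trajectory_kernel ::
  "('s::finite \<Rightarrow> 'a::finite \<Rightarrow> (real \<times> 's) measure) \<Rightarrow> ('s, 'a) policy \<Rightarrow> 's \<Rightarrow> 'a \<Rightarrow>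
   nat \<Rightarrow> (nat \<Rightarrow> real \<times> 's \<times> 'a) \<Rightarrow> (real \<times> 's \<times> 'a) measure" where
  "trajectory_kernel p \<pi> s a t \<omega> =
     (case t of 0 \<Rightarrow> return step_space (0, s, a) | Suc n \<Rightarrow> step_kernel p \<pi> (\<omega> n))"

definition trajectory ::
  "('s::finite \<Rightarrow> 'a::finite \<Rightarrow> (real \<times> 's) measure) \<Rightarrow> ('s, 'a) policy \<Rightarrow> 's \<Rightarrow> 'a \<Rightarrow>
   (nat \<Rightarrow> real \<times> 's \<times> 'a) measure" where
  "trajectory p \<pi> s a =
     projective_family.lim UNIV
       (Ionescu_Tulcea.CI (trajectory_kernel p \<pi> s a) (\<lambda>_. step_space)) (\<lambda>_. step_space)"

lemma measurable_step_kernel: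
  assumes "transition_kernel p"
  shows "step_kernel p \<pi> \<in> measurable step_space (prob_algebra step_space)"
proof -
  have p: "p s a \<in> space (prob_algebra (borel \<Otimes>\<^sub>M count_space UNIV))" for s a
    using assms by (simp add: transition_kernel_def)
  have \<pi>: "measure_pmf (\<pi> s') \<in> space (prob_algebra (count_space UNIV))" for s'
    by (simp add: space_prob_algebra measure_pmf.prob_space_axioms)
  have "(\<lambda>x. distr (measure_pmf (\<pi> s')) step_space (\<lambda>a'. (fst x, s', a')))
      \<in> measurable (borel \<Otimes>\<^sub>M count_space UNIV) (prob_algebra step_space)" for s'
    by (rule measurable_distr_prob_space2[OF measurable_const[OF \<pi>]]) measurable
  from measurable_compose_countable[OF this measurable_snd]
  have draw: "(\<lambda>x. distr (measure_pmf (\<pi> (snd x))) step_space (\<lambda>a'. (fst x, snd x, a')))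
      \<in> measurable (borel \<Otimes>\<^sub>M count_space UNIV) (prob_algebra step_space)" .
  have "(\<lambda>x. p (fst (snd x)) a) \<in>
      measurable step_space (prob_algebra (borel \<Otimes>\<^sub>M count_space UNIV))" for a
    by (rule measurable_compose_countable[where f = "\<lambda>s _. p s a", OF measurable_const[OF p]])
      measurable
  from measurable_compose_countable[where f = "\<lambda>a x. p (fst (snd x)) a", OF this,
      where g = "\<lambda>x. snd (snd x)"]
  have "(\<lambda>x. p (fst (snd x)) (snd (snd x))) \<in>
      measurable step_space (prob_algebra (borel \<Otimes>\<^sub>M count_space UNIV))"
    by measurable
  then show ?thesis
    unfolding step_kernel_def case_prod_beta by (rule measurable_bind_prob_space[OF _ draw])
qed

lemma Ionescu_Tulcea_trajectory_kernel:
  assumes "transition_kernel p"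
  shows "Ionescu_Tulcea (trajectory_kernel p \<pi> s a) (\<lambda>_. step_space)"
proof -
  have K: "trajectory_kernel p \<pi> s a t
      \<in> measurable (PiM {0..<t} (\<lambda>_. step_space)) (prob_algebra step_space)" for t
  proof (cases t)
    case 0
    have "return step_space (0, s, a) \<in> space (prob_algebra step_space)"
      by (simp add: space_prob_algebra space_pair_measure prob_space_return)
    from measurable_const[OF this] 0 show ?thesis
      by (simp add: trajectory_kernel_def[abs_def])
  next
    case (Suc n)
    then have "(\<lambda>\<omega>. \<omega> n) \<in> measurable (PiM {0..<t} (\<lambda>_. step_space)) step_space"
      by (intro measurable_component_singleton) simp
    from measurable_compose[OF this measurable_step_kernel[OF assms]] Suc show ?thesis
      by (simp add: trajectory_kernel_def[abs_def])
  qed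
  have "prob_space (trajectory_kernel p \<pi> s a t x)"
    if "x \<in> space (PiM {0..<t} (\<lambda>_. step_space))" for t x
    using measurable_space[OF K that] by (simp add: space_prob_algebra)
  with measurable_prob_algebraD[OF K] show ?thesis
    by (rule Ionescu_Tulcea.intro)
qed

definition Q_value ::
  "('s::finite \<Rightarrow> 'a::finite \<Rightarrow> (real \<times> 's) measure) \<Rightarrow> real \<Rightarrow> ('s, 'a) policy \<Rightarrow> 's \<times> 'a \<Rightarrow> real" where
  "Q_value p \<gamma> \<pi> = (\<lambda>(s, a). \<integral>\<omega>. (\<Sum>t. \<gamma> ^ t * fst (\<omega> (Suc t))) \<partial>trajectory p \<pi> s a)"

definition V_value ::
  "('s::finite \<Rightarrow> 'a::finite \<Rightarrow> (real \<times> 's) measure) \<Rightarrow> real \<Rightarrow> ('s, 'a) policy \<Rightarrow> 's \<Rightarrow> real" where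
  "V_value p \<gamma> \<pi> s = (\<Sum>a\<in>UNIV. pmf (\<pi> s) a * Q_value p \<gamma> \<pi> (s, a))"

text \<open>
  A policy is optimal if it maximizes the state value simultaneously for every initial state and is
  greedy with respect to its own state action value function.  Ties may leave several optimal
  policies; they all have the same state action value function, so the choice in \<open>Q_star\<close>
  is immaterial.
\<close>

definition optimal_policy ::
  "('s::finite \<Rightarrow> 'a::finite \<Rightarrow> (real \<times> 's) measure) \<Rightarrow> real \<Rightarrow> ('s, 'a) policy \<Rightarrow> bool" where
  "optimal_policy p \<gamma> \<pi> \<longleftrightarrow>
     (\<forall>s \<pi>'. V_value p \<gamma> \<pi>' s \<le> V_value p \<gamma> \<pi> s) \<and>
     (\<forall>s. \<exists>a. pmf (\<pi> s) a = 1 \<and> (\<forall>b. Q_value p \<gamma> \<pi> (s, b) \<le> Q_value p \<gamma> \<pi> (s, a)))"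

definition Q_star ::
  "('s::finite \<Rightarrow> 'a::finite \<Rightarrow> (real \<times> 's) measure) \<Rightarrow> real \<Rightarrow> 's \<times> 'a \<Rightarrow> real" where
  "Q_star p \<gamma> = Q_value p \<gamma> (SOME \<pi>. optimal_policy p \<gamma> \<pi>)"


section \<open>The Q-learning iteration\<close>

definition learning_rate :: "(nat \<Rightarrow> real) \<Rightarrow> 's \<times> 'a \<Rightarrow> 's \<Rightarrow> 'a \<Rightarrow> nat \<Rightarrow> real" where
  "learning_rate c x s a t = (if (s, a) = x then c t else 0)"

text \<open>
  The iteration along one realization \<open>s\<close>, \<open>a\<close>, \<open>r\<close> of the state, action and reward sequences.
\<close>

primrec Q_learning ::
  "(nat \<Rightarrow> real) \<Rightarrow> real \<Rightarrow> ('s \<times> 'a::finite \<Rightarrow> real) \<Rightarrow>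
   (nat \<Rightarrow> 's) \<Rightarrow> (nat \<Rightarrow> 'a) \<Rightarrow> (nat \<Rightarrow> real) \<Rightarrow> nat \<Rightarrow> 's \<times> 'a \<Rightarrow> real" where
  "Q_learning c \<gamma> Q0 s a r 0 = Q0"
| "Q_learning c \<gamma> Q0 s a r (Suc t) = (\<lambda>x.
     (1 - learning_rate c x (s t) (a t) t) * Q_learning c \<gamma> Q0 s a r t x
     + learning_rate c x (s t) (a t) t
       * (r t + \<gamma> * (MAX b. Q_learning c \<gamma> Q0 s a r t (s (Suc t), b))))"

definition W_norm :: "('x::finite \<Rightarrow> real) \<Rightarrow> real" where
  "W_norm f = (MAX x. \<bar>f x\<bar>)"

end

theory Submission
  imports Defs
begin

text \<open>
  Write \<open>\<alpha>\<^sub>t x\<close> for the learning rate of the state-action pair \<open>x\<close> at time \<open>t\<close> and \<open>T\<close> for the Bellman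
  optimality operator (\<open>bellman\<close>), a \<open>\<gamma>\<close>-contraction in the maximum norm.  The iteration reads
  \<open>Q\<^sub>t\<^sub>+\<^sub>1 x = (1 - \<alpha>\<^sub>t x) * Q\<^sub>t x + \<alpha>\<^sub>t x * (T Q\<^sub>t x + w\<^sub>t)\<close>, where the noise \<open>w\<^sub>t\<close> has conditional mean
  zero given the history.  Without noise, it would converge to the fixed point of \<open>T\<close>: every component
  is averaged towards a value that is closer to the fixed point by the factor \<open>\<gamma>\<close>, and it forgets its
  past because its learning rates are not summable (\<open>asynchronous_contraction_tendsto_0\<close>).

  The noise is removed realization by realization.  If the series \<open>\<Sum>\<^sub>t \<alpha>\<^sub>t x * w\<^sub>t\<close> converges, then adding
  its tail, which tends to \<open>0\<close>, to \<open>Q\<^sub>t x\<close> gives a sequence that satisfies the noise-free recursion up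
  to a vanishing perturbation (\<open>Q_learning_tendsto_of_noise_summable\<close>).  Almost sure convergence of the
  series follows from the square-summability of the step sizes by Kolmogorov's maximal inequality
  (\<open>AE_summable\<close>, \<open>AE_summable_weighted_noise\<close>), provided that the increments have bounded
  second moments.

  For the iterates, which multiply the randomness of the transitions, such a bound is not available
  in advance.  The noise is therefore split.  The reward part, \<open>r\<^sub>t\<close> minus its conditional mean, has
  bounded variance outright, and its series alone forces \<open>Q\<^sub>t\<close> to be bounded along each realization
  (\<open>Q_learning_bounded\<close>), because a maximum over actions is nonexpansive at whatever state comes next.
  The transition part is a finite sum over possible next states \<open>z\<close> of the centred indicator of \<open>z\<close>
  times the maximum of \<open>Q\<^sub>t\<close> at \<open>z\<close>.  With this maximum truncated at level \<open>K\<close>, its series converges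
  almost surely for all natural numbers \<open>K\<close> simultaneously, and on a realization whose iterates are
  bounded by \<open>K\<close> the truncation has no effect.

  It remains to see that \<^const>\<open>Q_star\<close>, defined through the trajectory measure, is a fixed point of \<open>T\<close>.
  The trajectory is a Markov chain (\<open>trajectory_marginals\<close>), so the value of a policy is a discounted
  series of iterates of its transition operator and satisfies the evaluation equation
  (\<open>Q_value_Bellman\<close>).  For a greedy policy this is the optimality equation, and optimal policies exist
  because a policy that is greedy for a fixed point of \<open>T\<close> is optimal (\<open>optimal_policy_exists\<close>).
\<close>

section \<open>The maximum norm and maxima over finite types\<close>

lemma abs_le_W_norm: "\<bar>f x\<bar> \<le> W_norm f"
  unfolding W_norm_def by (rule Max_ge) auto

lemma W_norm_le_iff: "W_norm f \<le> d \<longleftrightarrow> (\<forall>x. \<bar>f x\<bar> \<le> d)"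
  unfolding W_norm_def by (subst Max_le_iff) auto

lemma W_norm_nonneg: "0 \<le> W_norm f"
  using abs_le_W_norm[of f undefined] by linarith

lemma W_norm_tendsto_0:
  fixes f :: "nat \<Rightarrow> 'x::finite \<Rightarrow> real"
  assumes "\<And>x. (\<lambda>t. f t x) \<longlonglongrightarrow> 0"
  shows "(\<lambda>t. W_norm (f t)) \<longlonglongrightarrow> 0"
proof (rule order_tendstoI)
  fix y :: real assume "y < 0"
  then have "y < W_norm (f t)" for t using W_norm_nonneg[of "f t"] by linarith
  then show "eventually (\<lambda>t. y < W_norm (f t)) sequentially" by simp
next
  fix y :: real assume "0 < y"
  have "\<forall>x. eventually (\<lambda>t. \<bar>f t x\<bar> < y) sequentially"
    using order_tendstoD(2)[OF tendsto_rabs_zero[OF assms] \<open>0 < y\<close>] by simp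
  then have "eventually (\<lambda>t. \<forall>x. \<bar>f t x\<bar> < y) sequentially" by (simp add: eventually_all_finite)
  then show "eventually (\<lambda>t. W_norm (f t) < y) sequentially" by (simp add: W_norm_def)
qed

lemma abs_Max_diff_le:
  fixes f g :: "'b::finite \<Rightarrow> real"
  assumes "\<And>b. \<bar>f b - g b\<bar> \<le> d"
  shows "\<bar>(MAX b. f b) - (MAX b. g b)\<bar> \<le> d"
proof -
  have *: "(MAX b. f b) \<le> (MAX b. g b) + d" if "\<And>b. f b \<le> g b + d" for f g :: "'b \<Rightarrow> real"
  proof (rule Max.boundedI)
    fix y assume "y \<in> range f"
    then obtain b where "y = f b" by auto
    moreover have "g b \<le> (MAX b. g b)" by (rule Max_ge) auto
    ultimately show "y \<le> (MAX b. g b) + d" using that[of b] by linarith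
  qed auto
  have "f b \<le> g b + d" "g b \<le> f b + d" for b
    using assms[of b] by linarith+
  then have "(MAX b. f b) \<le> (MAX b. g b) + d" "(MAX b. g b) \<le> (MAX b. f b) + d"
    using *[of f g] *[of g f] by blast+
  then show ?thesis by linarith
qed

lemma abs_Max_le:
  fixes f :: "'b::finite \<Rightarrow> real"
  assumes "\<And>b. \<bar>f b\<bar> \<le> d"
  shows "\<bar>MAX b. f b\<bar> \<le> d"
  using abs_Max_diff_le[of f "\<lambda>_. 0" d] assms by simp

section \<open>Asynchronous contractions\<close>

text \<open>
Unrolling the recursion multiplies the initial error by \<open>\<Prod>(1 - \<alpha>\<^sub>t) \<le> exp (- \<Sum>\<alpha>\<^sub>t)\<close>, which tends
to \<open>0\<close> because the step sizes are not summable: the initial value is forgotten.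
\<close>

lemma averaging_eventually_le:
  fixes u \<alpha> :: "nat \<Rightarrow> real"
  assumes rate: "\<And>t. \<alpha> t \<in> {0..1}"
    and diverges: "filterlim (\<lambda>n. \<Sum>t<n. \<alpha> t) at_top sequentially"
    and step: "eventually (\<lambda>t. u (Suc t) \<le> (1 - \<alpha> t) * u t + \<alpha> t * b) sequentially"
    and "0 < \<delta>"
  shows "eventually (\<lambda>t. u t \<le> b + \<delta>) sequentially"
proof -
  obtain m where m: "\<And>t. m \<le> t \<Longrightarrow> u (Suc t) \<le> (1 - \<alpha> t) * u t + \<alpha> t * b"
    using step by (auto simp: eventually_sequentially)
  define S where "S n = (\<Sum>t<n. \<alpha> t)" for n
  define C where "C = max 0 (u m - b)"
  have bound: "u n - b \<le> C * exp (S m - S n)" if "m \<le> n" for n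
    using that
  proof (induction n rule: dec_induct)
    case base
    show ?case by (simp add: C_def)
  next
    case (step n)
    have "u (Suc n) - b \<le> (1 - \<alpha> n) * (u n - b)"
      using m[OF step(1)] by (simp add: algebra_simps)
    also have "\<dots> \<le> (1 - \<alpha> n) * (C * exp (S m - S n))"
      using rate[of n] step.IH by (intro mult_left_mono) auto
    also have "\<dots> \<le> exp (- \<alpha> n) * (C * exp (S m - S n))"
      using exp_ge_add_one_self[of "- \<alpha> n"] by (intro mult_right_mono) (auto simp: C_def)
    also have "\<dots> = C * exp (S m - S (Suc n))"
      by (simp add: S_def exp_diff exp_minus exp_add field_simps)
    finally show ?case .
  qed
  have "filterlim (\<lambda>n. - S n) at_bot sequentially"
    using diverges by (simp add: S_def filterlim_uminus_at_bot)
  then have "(\<lambda>n. C * exp (S m) * exp (- S n)) \<longlonglongrightarrow> C * exp (S m) * 0"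
    by (intro tendsto_mult tendsto_const filterlim_compose[OF exp_at_bot])
  then have "eventually (\<lambda>n. C * exp (S m) * exp (- S n) < \<delta>) sequentially"
    using \<open>0 < \<delta>\<close> by (auto dest: order_tendstoD)
  with eventually_ge_at_top[of m] show ?thesis
  proof eventually_elim
    case (elim n)
    have "C * exp (S m - S n) = C * exp (S m) * exp (- S n)"
      by (simp add: exp_diff exp_minus divide_inverse)
    then show ?case using elim bound[of n] by linarith
  qed
qed

text \<open>
Every step is a convex combination, so a bound \<open>B\<close> on all components is inherited as soon as
\<open>\<gamma> B + d \<le> B\<close>.
\<close>

lemma asynchronous_contraction_bounded:
  fixes Z :: "nat \<Rightarrow> 'x::finite \<Rightarrow> real"
  assumes rate: "\<And>t x. \<alpha> t x \<in> {0..1}"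
    and \<gamma>: "0 \<le> \<gamma>" "\<gamma> < 1"
    and e: "\<And>t. e t \<le> d"
    and step: "\<And>t x. \<bar>Z (Suc t) x\<bar>
                 \<le> (1 - \<alpha> t x) * \<bar>Z t x\<bar> + \<alpha> t x * (\<gamma> * W_norm (Z t) + e t)"
  shows "\<exists>B. \<forall>t. W_norm (Z t) \<le> B"
proof -
  define B where "B = max (W_norm (Z 0)) (d / (1 - \<gamma>))"
  have "d / (1 - \<gamma>) \<le> B" by (simp add: B_def)
  then have B: "\<gamma> * B + d \<le> B" using \<gamma> by (simp add: field_simps)
  have "W_norm (Z t) \<le> B" for t
  proof (induction t)
    case 0
    show ?case by (simp add: B_def)
  next
    case (Suc t)
    have "\<bar>Z (Suc t) x\<bar> \<le> B" for x
    proof -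
      have "\<bar>Z (Suc t) x\<bar> \<le> (1 - \<alpha> t x) * \<bar>Z t x\<bar> + \<alpha> t x * (\<gamma> * W_norm (Z t) + e t)"
        by (rule step)
      also have "\<dots> \<le> (1 - \<alpha> t x) * B + \<alpha> t x * B"
      proof (intro add_mono mult_left_mono)
        show "\<bar>Z t x\<bar> \<le> B" using abs_le_W_norm[of "Z t" x] Suc by linarith
        show "\<gamma> * W_norm (Z t) + e t \<le> B"
          using mult_left_mono[OF Suc \<gamma>(1)] e[of t] B by linarith
      qed (use rate[of t x] in auto)
      finally show ?thesis by (simp add: algebra_simps)
    qed
    then show ?case by (simp add: W_norm_le_iff)
  qed
  then show ?thesis by blast
qed

text \<open>
Each component is averaged towards a target of size \<open>\<gamma> * W_norm (Z t)\<close> up to a vanishing error.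
If all components eventually stay below \<open>D\<close>, averaging brings each of them, in its own time, below
a bound slightly larger than \<open>\<gamma> D\<close>; since there are finitely many components, the norm follows, and
the argument can be repeated.
\<close>

lemma asynchronous_contraction_tendsto_0:
  fixes Z :: "nat \<Rightarrow> 'x::finite \<Rightarrow> real"
  assumes rate: "\<And>t x. \<alpha> t x \<in> {0..1}"
    and diverges: "\<And>x. filterlim (\<lambda>n. \<Sum>t<n. \<alpha> t x) at_top sequentially"
    and \<gamma>: "0 \<le> \<gamma>" "\<gamma> < 1"
    and e: "e \<longlonglongrightarrow> 0"
    and step: "\<And>t x. \<bar>Z (Suc t) x\<bar>
                 \<le> (1 - \<alpha> t x) * \<bar>Z t x\<bar> + \<alpha> t x * (\<gamma> * W_norm (Z t) + e t)"
  shows "(\<lambda>t. W_norm (Z t)) \<longlonglongrightarrow> 0"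
proof (rule order_tendstoI)
  fix y :: real assume "y < 0"
  then have "y < W_norm (Z t)" for t
    using W_norm_nonneg[of "Z t"] by linarith
  then show "eventually (\<lambda>t. y < W_norm (Z t)) sequentially" by simp
next
  fix y :: real assume "0 < y"
  define \<epsilon> where "\<epsilon> = y / 2"
  have \<epsilon>: "0 < \<epsilon>" "\<epsilon> < y" using \<open>0 < y\<close> by (auto simp: \<epsilon>_def)
  define \<beta> where "\<beta> = (1 + \<gamma>) / 2"
  have \<beta>: "0 \<le> \<beta>" "\<beta> < 1" using \<gamma> by (auto simp: \<beta>_def)
  have "Bseq e" using e by (intro convergent_imp_Bseq convergentI)
  then obtain d where "\<And>t. \<bar>e t\<bar> \<le> d" by (auto simp: Bseq_def)
  then have "\<And>t. e t \<le> d" by (meson abs_le_D1)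
  from asynchronous_contraction_bounded[where \<alpha> = \<alpha> and Z = Z and e = e, OF rate \<gamma> this step]
  obtain B where B: "\<And>t. W_norm (Z t) \<le> B" by blast
  \<comment> \<open>One round of averaging shrinks any eventual bound \<open>D\<close> by the factor \<open>\<beta>\<close>, strictly between
    \<open>\<gamma>\<close> and \<open>1\<close>, as long as \<open>D\<close> dominates the target accuracy \<open>\<epsilon>\<close>.\<close>
  have shrink: "eventually (\<lambda>t. W_norm (Z t) \<le> \<beta> * D) sequentially"
    if D: "eventually (\<lambda>t. W_norm (Z t) \<le> D) sequentially" "\<epsilon> \<le> D" for D
  proof -
    \<comment> \<open>The gap \<open>\<beta> D - \<gamma> D\<close> is split evenly between the error \<open>e\<close> and the averaging lemma.\<close>
    define \<eta> where "\<eta> = (1 - \<gamma>) / 4 * D"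
    have "0 < \<eta>" using \<gamma> \<epsilon> D by (simp add: \<eta>_def)
    have "eventually (\<lambda>t. \<bar>Z t x\<bar> \<le> (\<gamma> * D + \<eta>) + \<eta>) sequentially" for x
    proof (rule averaging_eventually_le[of "\<lambda>t. \<alpha> t x"])
      have "eventually (\<lambda>t. e t < \<eta>) sequentially"
        using e \<open>0 < \<eta>\<close> by (rule order_tendstoD)
      with D(1) show "eventually (\<lambda>t. \<bar>Z (Suc t) x\<bar>
          \<le> (1 - \<alpha> t x) * \<bar>Z t x\<bar> + \<alpha> t x * (\<gamma> * D + \<eta>)) sequentially"
      proof eventually_elim
        case (elim t)
        have "\<alpha> t x * (\<gamma> * W_norm (Z t) + e t) \<le> \<alpha> t x * (\<gamma> * D + \<eta>)"
          using rate[of t x] elim \<gamma> by (intro mult_left_mono add_mono) auto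
        then show ?case using step[of t x] by linarith
      qed
    qed (use rate diverges \<open>0 < \<eta>\<close> in auto)
    moreover have "(\<gamma> * D + \<eta>) + \<eta> = \<beta> * D" by (simp add: \<eta>_def \<beta>_def field_simps)
    ultimately have "\<forall>x. eventually (\<lambda>t. \<bar>Z t x\<bar> \<le> \<beta> * D) sequentially" by simp
    then have "eventually (\<lambda>t. \<forall>x. \<bar>Z t x\<bar> \<le> \<beta> * D) sequentially"
      by (simp add: eventually_all_finite)
    then show ?thesis by (simp add: W_norm_le_iff)
  qed
  have iterate: "eventually (\<lambda>t. W_norm (Z t) \<le> max \<epsilon> (\<beta> ^ n * B)) sequentially" for n
  proof (induction n)
    case 0
    show ?case using B by (auto simp: le_max_iff_disj)
  next
    case (Suc n)
    from shrink[OF this] have "eventually (\<lambda>t. W_norm (Z t) \<le> \<beta> * max \<epsilon> (\<beta> ^ n * B)) sequentially"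
      by simp
    moreover have "\<beta> * max \<epsilon> (\<beta> ^ n * B) \<le> max \<epsilon> (\<beta> ^ Suc n * B)"
    proof -
      have "\<beta> * \<epsilon> \<le> \<epsilon>" using \<beta> \<epsilon> by (simp add: mult_left_le_one_le)
      then show ?thesis by (auto simp: max_def mult.assoc)
    qed
    ultimately show ?case by (auto elim: eventually_mono)
  qed
  have "(\<lambda>n. \<beta> ^ n * B) \<longlonglongrightarrow> 0 * B"
    using \<beta> by (intro tendsto_mult LIMSEQ_power_zero tendsto_const) auto
  then have "eventually (\<lambda>n. \<beta> ^ n * B < \<epsilon>) sequentially"
    using \<epsilon> by (auto dest: order_tendstoD)
  then obtain n where "\<beta> ^ n * B < \<epsilon>" by (auto simp: eventually_sequentially)
  with iterate[of n] show "eventually (\<lambda>t. W_norm (Z t) < y) sequentially"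
    using \<epsilon> by (auto elim!: eventually_mono)
qed

text \<open>
The tail \<open>N\<^sub>t\<close> of a convergent series of noise terms satisfies \<open>N\<^sub>t\<^sub>+\<^sub>1 = N\<^sub>t - f\<^sub>t\<close>.  Adding it to an
iterate that receives the noise \<open>f\<^sub>t\<close> therefore yields a noise-free recursion for a sequence that has
the same limit.
\<close>

lemma series_tail_tendsto_0:
  fixes f :: "nat \<Rightarrow> real"
  assumes "summable f"
  shows "(\<lambda>t. suminf f - sum f {..<t}) \<longlonglongrightarrow> 0"
proof -
  have "(\<lambda>t. suminf f - sum f {..<t}) \<longlonglongrightarrow> suminf f - suminf f"
    by (intro tendsto_diff tendsto_const summable_LIMSEQ assms)
  then show ?thesis by simp
qed

section \<open>The Bellman operator\<close>

text \<open>
The Bellman optimality operator of a finite decision process with mean rewards \<open>R\<close> and transition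
probabilities \<open>P\<close>; rewards enter it only through their means.
\<close>

definition bellman ::
  "('x \<Rightarrow> real) \<Rightarrow> ('x \<Rightarrow> 's::finite \<Rightarrow> real) \<Rightarrow> real \<Rightarrow> ('s \<times> 'a::finite \<Rightarrow> real) \<Rightarrow> 'x \<Rightarrow> real" where
  "bellman R P \<gamma> q x = R x + \<gamma> * (\<Sum>z\<in>UNIV. P x z * (MAX b. q (z, b)))"

lemma bellman_contraction:
  fixes P :: "'x \<Rightarrow> 's::finite \<Rightarrow> real" and q q' :: "'s \<times> 'a::finite \<Rightarrow> real"
  assumes P: "\<And>x z. 0 \<le> P x z" "\<And>x. (\<Sum>z\<in>UNIV. P x z) = 1" and "0 \<le> \<gamma>"
    and d: "\<And>y. \<bar>q y - q' y\<bar> \<le> d"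
  shows "\<bar>bellman R P \<gamma> q x - bellman R P \<gamma> q' x\<bar> \<le> \<gamma> * d"
proof -
  have "bellman R P \<gamma> q x - bellman R P \<gamma> q' x
      = \<gamma> * (\<Sum>z\<in>UNIV. P x z * ((MAX b. q (z, b)) - (MAX b. q' (z, b))))"
    by (simp add: bellman_def algebra_simps sum_subtractf)
  also have "\<bar>\<dots>\<bar> \<le> \<gamma> * (\<Sum>z\<in>UNIV. P x z * d)"
    unfolding abs_mult abs_of_nonneg[OF \<open>0 \<le> \<gamma>\<close>]
  proof (intro mult_left_mono \<open>0 \<le> \<gamma>\<close> order_trans[OF sum_abs] sum_mono)
    fix z
    show "\<bar>P x z * ((MAX b. q (z, b)) - (MAX b. q' (z, b)))\<bar> \<le> P x z * d"
      unfolding abs_mult abs_of_nonneg[OF P(1)]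
      by (intro mult_left_mono abs_Max_diff_le P d)
  qed
  also have "\<dots> = \<gamma> * d" by (simp add: P flip: sum_distrib_right)
  finally show ?thesis .
qed

text \<open>
Successive approximation: the increments of the iterates decay like \<open>\<gamma> ^ n\<close>, and the operator is
continuous because it is a contraction.
\<close>

lemma bellman_fixed_point_exists:
  fixes P :: "'s::finite \<times> 'a::finite \<Rightarrow> 's \<Rightarrow> real"
  assumes P: "\<And>x z. 0 \<le> P x z" "\<And>x. (\<Sum>z\<in>UNIV. P x z) = 1" and \<gamma>: "0 \<le> \<gamma>" "\<gamma> < 1"
  shows "\<exists>q. bellman R P \<gamma> q = q"
proof -
  define q :: "nat \<Rightarrow> 's \<times> 'a \<Rightarrow> real" where "q n = (bellman R P \<gamma> ^^ n) (\<lambda>_ :: 's \<times> 'a. 0)" for n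
  have q_Suc: "q (Suc n) = bellman R P \<gamma> (q n)" for n by (simp add: q_def)
  define d where "d = W_norm (\<lambda>x. q 1 x - q 0 x)"
  have step: "\<bar>q (Suc n) x - q n x\<bar> \<le> \<gamma> ^ n * d" for n x
  proof (induction n arbitrary: x)
    case 0
    show ?case using abs_le_W_norm[of "\<lambda>x. q 1 x - q 0 x"] by (simp add: d_def)
  next
    case (Suc n)
    show ?case
      using bellman_contraction[where P = P and q = "q (Suc n)" and q' = "q n",
          OF P \<gamma>(1) Suc, where R = R and x = x]
      by (simp add: q_Suc mult.assoc)
  qed
  have "convergent (\<lambda>n. q n x)" for x
  proof -
    have "summable (\<lambda>n. \<gamma> ^ n * d)"
      using \<gamma> by (intro summable_mult2 summable_geometric) auto
    then have "summable (\<lambda>n. q (Suc n) x - q n x)"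
      by (rule summable_comparison_test'[where N = 0]) (use step in auto)
    then have "convergent (\<lambda>n. q n x - q 0 x)"
      unfolding summable_iff_convergent by (simp only: sum_lessThan_telescope[of "\<lambda>n. q n x"])
    from convergent_add[OF this convergent_const[of "q 0 x"]] show ?thesis by simp
  qed
  then have lim: "(\<lambda>n. q n x) \<longlonglongrightarrow> lim (\<lambda>n. q n x)" for x
    by (simp add: convergent_LIMSEQ_iff)
  define l where "l x = lim (\<lambda>n. q n x)" for x
  have "bellman R P \<gamma> l x = l x" for x
  proof (rule LIMSEQ_unique)
    show "(\<lambda>n. q (Suc n) x) \<longlonglongrightarrow> l x"
      using LIMSEQ_Suc[OF lim[of x]] by (simp add: l_def)
    have "(\<lambda>n. W_norm (\<lambda>y. q n y - l y)) \<longlonglongrightarrow> 0"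
      using lim by (intro W_norm_tendsto_0 LIM_zero) (simp add: l_def)
    then have "(\<lambda>n. \<gamma> * W_norm (\<lambda>y. q n y - l y)) \<longlonglongrightarrow> \<gamma> * 0"
      by (intro tendsto_mult tendsto_const)
    then have bound: "(\<lambda>n. \<gamma> * W_norm (\<lambda>y. q n y - l y)) \<longlonglongrightarrow> 0" by simp
    have "\<bar>bellman R P \<gamma> (q n) x - bellman R P \<gamma> l x\<bar> \<le> \<gamma> * W_norm (\<lambda>y. q n y - l y)" for n
      by (rule bellman_contraction[OF P \<gamma>(1)]) (rule abs_le_W_norm[where f = "\<lambda>y. q n y - l y"])
    then have "(\<lambda>n. bellman R P \<gamma> (q n) x - bellman R P \<gamma> l x) \<longlonglongrightarrow> 0"
      by (intro Lim_null_comparison[OF _ bound] always_eventually) simp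
    then show "(\<lambda>n. q (Suc n) x) \<longlonglongrightarrow> bellman R P \<gamma> l x"
      by (simp add: q_Suc LIM_zero_cancel)
  qed
  then show ?thesis by blast
qed

section \<open>Q-learning along one realization\<close>

text \<open>
Truncated values serve as coefficients of the transition noise: they are bounded by a constant on
the whole probability space, whereas the iterates are bounded only along each single realization,
by a bound that varies with the realization.
\<close>

definition clip :: "real \<Rightarrow> real \<Rightarrow> real" where
  "clip K v = max (- K) (min K v)"

lemma clip_id: "\<bar>v\<bar> \<le> K \<Longrightarrow> clip K v = v"
  by (auto simp: clip_def)

lemma abs_clip_le: "0 \<le> K \<Longrightarrow> \<bar>clip K v\<bar> \<le> K"
  by (auto simp: clip_def)

lemma abs_convex_step_le:
  fixes \<alpha> :: real
  assumes "\<alpha> \<in> {0..1}" "\<bar>v\<bar> \<le> d"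
  shows "\<bar>(1 - \<alpha>) * u + \<alpha> * v\<bar> \<le> (1 - \<alpha>) * \<bar>u\<bar> + \<alpha> * d"
proof -
  have "\<bar>(1 - \<alpha>) * u + \<alpha> * v\<bar> \<le> \<bar>(1 - \<alpha>) * u\<bar> + \<bar>\<alpha> * v\<bar>" by (rule abs_triangle_ineq)
  also have "\<dots> = (1 - \<alpha>) * \<bar>u\<bar> + \<alpha> * \<bar>v\<bar>" using assms(1) by (simp add: abs_mult)
  also have "\<dots> \<le> (1 - \<alpha>) * \<bar>u\<bar> + \<alpha> * d" using assms by (intro add_left_mono mult_left_mono) auto
  finally show ?thesis .
qed

text \<open>
Only the noise of the rewards matters for boundedness, because the maximum over actions at the state
that is actually reached next is itself bounded by the norm of the iterate.  Once the tail of the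
reward noise is added, the iterates obey an asynchronous contraction with bounded errors.
\<close>

lemma Q_learning_bounded:
  fixes s :: "nat \<Rightarrow> 's::finite" and a :: "nat \<Rightarrow> 'a::finite" and r c :: "nat \<Rightarrow> real"
    and \<gamma> :: real and Q0 :: "'s \<times> 'a \<Rightarrow> real"
  defines "\<alpha> \<equiv> \<lambda>t x. learning_rate c x (s t) (a t) t"
  assumes \<gamma>: "0 \<le> \<gamma>" "\<gamma> < 1"
    and rate: "\<And>t. c t \<in> {0..1}"
    and reward_noise: "\<And>x. summable (\<lambda>t. \<alpha> t x * (r t - R x))"
  shows "\<exists>B. \<forall>t. W_norm (Q_learning c \<gamma> Q0 s a r t) \<le> B"
proof -
  define Q where "Q = Q_learning c \<gamma> Q0 s a r"
  define N where "N t x = (\<Sum>i. \<alpha> i x * (r i - R x)) - (\<Sum>i<t. \<alpha> i x * (r i - R x))" for t x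
  define Y where "Y t x = Q t x + N t x" for t x
  define e where "e t = W_norm R + (1 + \<gamma>) * W_norm (N t)" for t
  have \<alpha>: "\<alpha> t x \<in> {0..1}" for t x using rate[of t] by (simp add: \<alpha>_def learning_rate_def)
  have "(\<lambda>t. N t x) \<longlonglongrightarrow> 0" for x
    using series_tail_tendsto_0[OF reward_noise[of x]] by (simp add: N_def)
  then have N: "(\<lambda>t. W_norm (N t)) \<longlonglongrightarrow> 0" by (rule W_norm_tendsto_0)
  then have "Bseq (\<lambda>t. W_norm (N t))" by (intro convergent_imp_Bseq convergentI)
  then obtain d where "\<And>t. \<bar>W_norm (N t)\<bar> \<le> d" by (auto simp: Bseq_def)
  then have d: "\<And>t. W_norm (N t) \<le> d" by (meson abs_le_D1)
  have "\<exists>B. \<forall>t. W_norm (Y t) \<le> B"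
  proof (rule asynchronous_contraction_bounded[OF \<alpha> \<gamma>])
    show "e t \<le> W_norm R + (1 + \<gamma>) * d" for t
      unfolding e_def using \<gamma> by (intro add_left_mono mult_left_mono d) auto
    fix t x
    have "N (Suc t) x = N t x - \<alpha> t x * (r t - R x)" by (simp add: N_def)
    then have update: "Y (Suc t) x = (1 - \<alpha> t x) * Y t x
        + \<alpha> t x * (R x + \<gamma> * (MAX b. Q t (s (Suc t), b)) + N t x)"
      by (simp add: Y_def Q_def \<alpha>_def algebra_simps)
    have target: "\<bar>R x + \<gamma> * (MAX b. Q t (s (Suc t), b)) + N t x\<bar> \<le> \<gamma> * W_norm (Y t) + e t"
    proof -
      have "\<bar>Q t y\<bar> \<le> W_norm (Y t) + W_norm (N t)" for y
        using abs_le_W_norm[of "Y t" y] abs_le_W_norm[of "N t" y] by (simp add: Y_def)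
      then have "\<bar>MAX b. Q t (s (Suc t), b)\<bar> \<le> W_norm (Y t) + W_norm (N t)"
        by (intro abs_Max_le)
      then have "\<bar>\<gamma> * (MAX b. Q t (s (Suc t), b))\<bar> \<le> \<gamma> * (W_norm (Y t) + W_norm (N t))"
        using \<gamma> by (simp add: abs_mult mult_left_mono)
      then show ?thesis
        using abs_le_W_norm[of R x] abs_le_W_norm[of "N t" x] by (simp add: e_def algebra_simps)
    qed
    show "\<bar>Y (Suc t) x\<bar>
        \<le> (1 - \<alpha> t x) * \<bar>Y t x\<bar> + \<alpha> t x * (\<gamma> * W_norm (Y t) + e t)"
      unfolding update by (rule abs_convex_step_le[OF \<alpha> target])
  qed
  then obtain B where B: "\<And>t. W_norm (Y t) \<le> B" by blast
  have "\<bar>Q t x\<bar> \<le> B + d" for t x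
    using abs_le_W_norm[of "Y t" x] abs_le_W_norm[of "N t" x] B[of t] d[of t] by (simp add: Y_def)
  then show ?thesis unfolding Q_def[symmetric] W_norm_le_iff by blast
qed

text \<open>
The deterministic half of the proof, for a single realization: if the accumulated noise of the
rewards and of each transition converges, then so do the iterates.  The transition noise is assumed
for every truncation level \<open>K\<close>; a level above the bound of the iterates leaves their maxima
unchanged.
\<close>

lemma Q_learning_tendsto_of_noise_summable:
  fixes s :: "nat \<Rightarrow> 's::finite" and a :: "nat \<Rightarrow> 'a::finite" and r c :: "nat \<Rightarrow> real"
    and \<gamma> :: real and Q0 :: "'s \<times> 'a \<Rightarrow> real"
  defines "\<alpha> \<equiv> \<lambda>t x. learning_rate c x (s t) (a t) t"
    and "Q \<equiv> Q_learning c \<gamma> Q0 s a r"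
  assumes P: "\<And>x z. 0 \<le> P x z" "\<And>x. (\<Sum>z\<in>UNIV. P x z) = 1" and \<gamma>: "0 \<le> \<gamma>" "\<gamma> < 1"
    and rate: "\<And>t. c t \<in> {0..1}"
    and diverges: "\<And>x. filterlim (\<lambda>n. \<Sum>t<n. \<alpha> t x) at_top sequentially"
    and fixed: "bellman R P \<gamma> q = q"
    and reward_noise: "\<And>x. summable (\<lambda>t. \<alpha> t x * (r t - R x))"
    and transition_noise: "\<And>x z K. summable (\<lambda>t. \<alpha> t x *
          (clip (real K) (MAX b. Q t (z, b)) * (indicator {z} (s (Suc t)) - P x z)))"
  shows "(\<lambda>t. W_norm (\<lambda>x. Q t x - q x)) \<longlonglongrightarrow> 0"
proof -
  have \<alpha>: "\<alpha> t x \<in> {0..1}" for t x using rate[of t] by (simp add: \<alpha>_def learning_rate_def)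
  define V where "V t z = (MAX b. Q t (z, b))" for t z
  define f where "f x t = \<alpha> t x * (r t + \<gamma> * V t (s (Suc t)) - bellman R P \<gamma> (Q t) x)" for x t
  from Q_learning_bounded[OF \<gamma> rate reward_noise[unfolded \<alpha>_def], of Q0]
  obtain B where "\<And>t. W_norm (Q t) \<le> B" by (auto simp: Q_def)
  moreover obtain K :: nat where "B \<le> real K" using real_arch_simple by blast
  ultimately have "W_norm (Q t) \<le> real K" for t by (meson order_trans)
  then have "\<bar>V t z\<bar> \<le> real K" for t z
    unfolding V_def by (intro abs_Max_le) (auto simp: W_norm_le_iff)
  then have clip_V: "clip (real K) (V t z) = V t z" for t z by (simp add: clip_id)
  \<comment> \<open>The total noise is a finite combination of the reward noise and of the noise of the
    indicators of the single next states.\<close>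
  have f_sum: "summable (f x)" for x
  proof -
    have "f x t = \<alpha> t x * (r t - R x)
        + \<gamma> * (\<Sum>z\<in>UNIV. \<alpha> t x * (V t z * (indicator {z} (s (Suc t)) - P x z)))" for t
    proof -
      have "V t (s (Suc t)) = (\<Sum>z\<in>UNIV. V t z * indicator {z} (s (Suc t)))"
        by (simp add: indicator_def)
      then have "(\<Sum>z\<in>UNIV. \<alpha> t x * (V t z * (indicator {z} (s (Suc t)) - P x z)))
          = \<alpha> t x * (V t (s (Suc t)) - (\<Sum>z\<in>UNIV. P x z * V t z))"
        by (simp add: sum_subtractf right_diff_distrib mult.commute[of "P x _"] flip: sum_distrib_left)
      then show ?thesis
        unfolding f_def bellman_def V_def[symmetric] by (simp only:) (simp add: algebra_simps)
    qed
    then have "f x = (\<lambda>t. \<alpha> t x * (r t - R x)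
        + \<gamma> * (\<Sum>z\<in>UNIV. \<alpha> t x * (V t z * (indicator {z} (s (Suc t)) - P x z))))"
      by blast
    moreover have "summable (\<lambda>t. \<alpha> t x * (V t z * (indicator {z} (s (Suc t)) - P x z)))" for z
      using transition_noise[of x K z, folded V_def] unfolding clip_V .
    ultimately show ?thesis
      by (auto intro!: summable_add summable_mult summable_sum reward_noise)
  qed
  define N where "N t x = (\<Sum>i. f x i) - (\<Sum>i<t. f x i)" for t x
  have "(\<lambda>t. N t x) \<longlonglongrightarrow> 0" for x
    using series_tail_tendsto_0[OF f_sum[of x]] by (simp add: N_def)
  then have N: "(\<lambda>t. W_norm (N t)) \<longlonglongrightarrow> 0" by (rule W_norm_tendsto_0)
  define Z where "Z t x = Q t x + N t x - q x" for t x
  have "(\<lambda>t. W_norm (Z t)) \<longlonglongrightarrow> 0"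
  proof (rule asynchronous_contraction_tendsto_0[OF \<alpha> diverges \<gamma>])
    have "(\<lambda>t. (1 + \<gamma>) * W_norm (N t)) \<longlonglongrightarrow> (1 + \<gamma>) * 0"
      by (intro tendsto_mult tendsto_const N)
    then show "(\<lambda>t. (1 + \<gamma>) * W_norm (N t)) \<longlonglongrightarrow> 0" by simp
    fix t x
    have "N (Suc t) x = N t x - f x t" by (simp add: N_def)
    moreover have "Q (Suc t) x = (1 - \<alpha> t x) * Q t x + \<alpha> t x * (r t + \<gamma> * V t (s (Suc t)))"
      by (simp add: Q_def \<alpha>_def V_def)
    ultimately have update: "Z (Suc t) x
        = (1 - \<alpha> t x) * Z t x + \<alpha> t x * (bellman R P \<gamma> (Q t) x - q x + N t x)"
      by (simp add: Z_def f_def algebra_simps)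
    have target: "\<bar>bellman R P \<gamma> (Q t) x - q x + N t x\<bar>
        \<le> \<gamma> * W_norm (Z t) + (1 + \<gamma>) * W_norm (N t)"
    proof -
      have "\<bar>Q t y - q y\<bar> \<le> W_norm (Z t) + W_norm (N t)" for y
        using abs_le_W_norm[of "Z t" y] abs_le_W_norm[of "N t" y] by (simp add: Z_def)
      from bellman_contraction[where P = P and q = "Q t" and q' = q,
          OF P \<gamma>(1) this, where R = R and x = x]
      show ?thesis
        using abs_le_W_norm[of "N t" x] by (simp add: fixed algebra_simps)
    qed
    show "\<bar>Z (Suc t) x\<bar>
        \<le> (1 - \<alpha> t x) * \<bar>Z t x\<bar> + \<alpha> t x * (\<gamma> * W_norm (Z t) + (1 + \<gamma>) * W_norm (N t))"
      unfolding update by (rule abs_convex_step_le[OF \<alpha> target])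
  qed
  have sq: "W_norm (\<lambda>x. Q t x - q x) \<le> W_norm (Z t) + W_norm (N t)" for t
    unfolding W_norm_le_iff
  proof
    fix x
    show "\<bar>Q t x - q x\<bar> \<le> W_norm (Z t) + W_norm (N t)"
      using abs_le_W_norm[of "Z t" x] abs_le_W_norm[of "N t" x] by (simp add: Z_def)
  qed
  show ?thesis
  proof (rule tendsto_sandwich[where f = "\<lambda>_. 0" and h = "\<lambda>t. W_norm (Z t) + W_norm (N t)"])
    show "(\<lambda>t. W_norm (Z t) + W_norm (N t)) \<longlonglongrightarrow> 0"
      using tendsto_add[OF \<open>(\<lambda>t. W_norm (Z t)) \<longlonglongrightarrow> 0\<close> N] by simp
  qed (auto simp: sq W_norm_nonneg)
qed

section \<open>Markov chains induced by policies\<close>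

text \<open>
Rewards may be unbounded, so the iterated-integral formula is needed for integrable functions; it
follows from the one for nonnegative functions by splitting into positive and negative parts.
\<close>

lemma integral_bind_integrable:
  fixes f :: "'b \<Rightarrow> real"
  assumes ne: "space M \<noteq> {}" and f [measurable]: "f \<in> borel_measurable B"
    and N [measurable]: "N \<in> measurable M (subprob_algebra B)"
    and inner: "\<And>x. x \<in> space M \<Longrightarrow> integrable (N x) f"
    and outer: "integrable M (\<lambda>x. \<integral>y. \<bar>f y\<bar> \<partial>N x)"
  shows "integrable (M \<bind> N) f"
    and "(\<integral>y. f y \<partial>(M \<bind> N)) = (\<integral>x. \<integral>y. f y \<partial>N x \<partial>M)"
proof -
  have nn: "(\<integral>\<^sup>+y. ennreal (g y) \<partial>(M \<bind> N)) = (\<integral>\<^sup>+x. ennreal (\<integral>y. g y \<partial>N x) \<partial>M)"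
    if [measurable]: "g \<in> borel_measurable B" and g: "\<And>y. 0 \<le> g y"
      "\<And>x. x \<in> space M \<Longrightarrow> integrable (N x) g" for g :: "'b \<Rightarrow> real"
    using g by (subst nn_integral_bind[OF _ N]) (auto intro!: nn_integral_cong nn_integral_eq_integral)
  have meas: "(\<lambda>x. \<integral>y. g y \<partial>N x) \<in> borel_measurable M"
    if [measurable]: "g \<in> borel_measurable B" and g: "\<And>y. 0 \<le> g y" for g :: "'b \<Rightarrow> real"
  proof -
    have "(\<lambda>x. enn2real (\<integral>\<^sup>+y. ennreal (g y) \<partial>N x)) \<in> borel_measurable M"
      by (rule borel_measurable_enn2real[OF measurable_compose[OF N
            nn_integral_measurable_subprob_algebra]]) measurable
    also have "?this \<longleftrightarrow> ?thesis"
      using g sets_kernel[OF N]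
      by (intro measurable_cong) (subst integral_eq_nn_integral, auto cong: measurable_cong_sets)
    finally show ?thesis .
  qed
  have abs_f: "integrable (N x) (\<lambda>y. \<bar>f y\<bar>)" if "x \<in> space M" for x
    using inner[OF that] by simp
  show int: "integrable (M \<bind> N) f"
  proof -
    have "(\<integral>\<^sup>+y. ennreal \<bar>f y\<bar> \<partial>(M \<bind> N)) = (\<integral>\<^sup>+x. ennreal (\<integral>y. \<bar>f y\<bar> \<partial>N x) \<partial>M)"
      by (rule nn) (use abs_f in auto)
    also have "\<dots> = ennreal (\<integral>x. \<integral>y. \<bar>f y\<bar> \<partial>N x \<partial>M)"
      by (rule nn_integral_eq_integral[OF outer]) simp
    finally show ?thesis
      using sets_bind[OF sets_kernel[OF N] ne]
      by (intro integrableI_bounded) (auto cong: measurable_cong_sets)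
  qed
  have part: "(\<integral>y. g y \<partial>(M \<bind> N)) = (\<integral>x. \<integral>y. g y \<partial>N x \<partial>M)"
    "integrable M (\<lambda>x. \<integral>y. g y \<partial>N x)" "integrable (M \<bind> N) g"
    "\<And>x. x \<in> space M \<Longrightarrow> integrable (N x) g"
    if g [measurable]: "g \<in> borel_measurable B" and nonneg: "\<And>y. 0 \<le> g y" and le: "\<And>y. g y \<le> \<bar>f y\<bar>"
    for g :: "'b \<Rightarrow> real"
  proof -
    show inner_g: "integrable (N x) g" if "x \<in> space M" for x
      using nonneg le sets_kernel[OF N that]
      by (intro Bochner_Integration.integrable_bound[OF inner[OF that]])
        (auto cong: measurable_cong_sets)
    show outer_g: "integrable M (\<lambda>x. \<integral>y. g y \<partial>N x)"
    proof (rule Bochner_Integration.integrable_bound[OF outer meas[OF g nonneg]], rule AE_I2)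
      fix x assume "x \<in> space M"
      then have "(\<integral>y. g y \<partial>N x) \<le> (\<integral>y. \<bar>f y\<bar> \<partial>N x)"
        using le by (intro integral_mono inner_g abs_f) auto
      then show "norm (\<integral>y. g y \<partial>N x) \<le> norm (\<integral>y. \<bar>f y\<bar> \<partial>N x)"
        using nonneg by simp
    qed
    show int_g: "integrable (M \<bind> N) g"
      using nonneg le sets_bind[OF sets_kernel[OF N] ne]
      by (intro Bochner_Integration.integrable_bound[OF int]) (auto cong: measurable_cong_sets)
    have "ennreal (\<integral>y. g y \<partial>(M \<bind> N)) = ennreal (\<integral>x. \<integral>y. g y \<partial>N x \<partial>M)"
      using nn[OF g nonneg inner_g] nonneg
      by (simp add: nn_integral_eq_integral int_g outer_g)
    then show "(\<integral>y. g y \<partial>(M \<bind> N)) = (\<integral>x. \<integral>y. g y \<partial>N x \<partial>M)"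
      using nonneg by simp
  qed
  have pm: "(\<lambda>y. max 0 (f y)) \<in> borel_measurable B" "(\<lambda>y. max 0 (- f y)) \<in> borel_measurable B"
    by measurable
  have pos_le: "0 \<le> max 0 (f y)" "max 0 (f y) \<le> \<bar>f y\<bar>"
    "0 \<le> max 0 (- f y)" "max 0 (- f y) \<le> \<bar>f y\<bar>" for y by auto
  note pos = part[OF pm(1) pos_le(1,2)] and neg = part[OF pm(2) pos_le(3,4)]
  have split: "f y = max 0 (f y) - max 0 (- f y)" for y by auto
  have "(\<integral>y. f y \<partial>(M \<bind> N)) = (\<integral>y. max 0 (f y) - max 0 (- f y) \<partial>(M \<bind> N))"
    by (rule Bochner_Integration.integral_cong[OF refl]) (rule split)
  also have "\<dots> = (\<integral>x. \<integral>y. max 0 (f y) \<partial>N x \<partial>M) - (\<integral>x. \<integral>y. max 0 (- f y) \<partial>N x \<partial>M)"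
    unfolding pos(1)[symmetric] neg(1)[symmetric]
    by (rule Bochner_Integration.integral_diff[OF pos(3) neg(3)])
  also have "\<dots> = (\<integral>x. (\<integral>y. max 0 (f y) \<partial>N x) - (\<integral>y. max 0 (- f y) \<partial>N x) \<partial>M)"
    by (rule Bochner_Integration.integral_diff[OF pos(2) neg(2), symmetric])
  also have "\<dots> = (\<integral>x. \<integral>y. f y \<partial>N x \<partial>M)"
  proof (rule Bochner_Integration.integral_cong[OF refl])
    fix x assume x: "x \<in> space M"
    have "(\<integral>y. max 0 (f y) \<partial>N x) - (\<integral>y. max 0 (- f y) \<partial>N x)
        = (\<integral>y. max 0 (f y) - max 0 (- f y) \<partial>N x)"
      by (rule Bochner_Integration.integral_diff[OF pos(4)[OF x] neg(4)[OF x], symmetric])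
    also have "\<dots> = (\<integral>y. f y \<partial>N x)"
      by (rule Bochner_Integration.integral_cong[OF refl]) (rule split[symmetric])
    finally show "(\<integral>y. max 0 (f y) \<partial>N x) - (\<integral>y. max 0 (- f y) \<partial>N x) = (\<integral>y. f y \<partial>N x)" .
  qed
  finally show "(\<integral>y. f y \<partial>(M \<bind> N)) = (\<integral>x. \<integral>y. f y \<partial>N x \<partial>M)" .
qed

lemma measurable_state_action:
  fixes g :: "'s::finite \<times> 'a::finite \<Rightarrow> 'b::topological_space"
  shows "(\<lambda>w. g (snd w)) \<in> borel_measurable step_space"
proof -
  have "g \<in> borel_measurable (count_space UNIV \<Otimes>\<^sub>M count_space UNIV)"
    by (simp add: pair_measure_countable countable_finite)
  then show ?thesis by (rule measurable_compose[OF measurable_snd])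
qed

definition expected_reward :: "('s \<Rightarrow> 'a \<Rightarrow> (real \<times> 's) measure) \<Rightarrow> 's \<times> 'a \<Rightarrow> real" where
  "expected_reward p x = (\<integral>y. fst y \<partial>p (fst x) (snd x))"

definition transition_prob :: "('s \<Rightarrow> 'a \<Rightarrow> (real \<times> 's) measure) \<Rightarrow> 's \<times> 'a \<Rightarrow> 's \<Rightarrow> real" where
  "transition_prob p x z = measure (p (fst x) (snd x)) (UNIV \<times> {z})"

text \<open>
The transition operator of the Markov chain of state-action pairs that a policy induces.
\<close>

definition policy_average ::
  "('s::finite \<Rightarrow> 'a::finite \<Rightarrow> (real \<times> 's) measure) \<Rightarrow> ('s, 'a) policy \<Rightarrow>
   ('s \<times> 'a \<Rightarrow> real) \<Rightarrow> 's \<times> 'a \<Rightarrow> real" where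
  "policy_average p \<pi> g x
     = (\<Sum>z\<in>UNIV. transition_prob p x z * (\<Sum>b\<in>UNIV. pmf (\<pi> z) b * g (z, b)))"

locale mdp =
  fixes p :: "'s::finite \<Rightarrow> 'a::finite \<Rightarrow> (real \<times> 's) measure"
  assumes kernel: "transition_kernel p"
    and integrable_reward: "\<And>x y. integrable (p x y) fst"
begin

lemma sets_p [measurable_cong]: "sets (p x y) = sets (borel \<Otimes>\<^sub>M count_space UNIV)"
  and prob_space_p: "prob_space (p x y)"
  using kernel by (auto simp: transition_kernel_def space_prob_algebra)

lemma space_p: "space (p x y) = UNIV"
  using sets_eq_imp_space_eq[OF sets_p[of x y]] by (simp add: space_pair_measure)

lemma integral_next_state:
  fixes g :: "'s \<Rightarrow> real"
  shows "integrable (p (fst x) (snd x)) (\<lambda>y. g (snd y))"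
    and "(\<integral>y. g (snd y) \<partial>p (fst x) (snd x)) = (\<Sum>z\<in>UNIV. transition_prob p x z * g z)"
proof -
  interpret prob_space "p (fst x) (snd x)" by (rule prob_space_p)
  have [measurable]: "UNIV \<times> {z} \<in> sets (p (fst x) (snd x))" for z
    unfolding sets_p by (intro pair_measureI) auto
  have *: "g (snd y) = (\<Sum>z\<in>UNIV. indicator (UNIV \<times> {z}) y * g z)" for y :: "real \<times> 's"
    by (cases y) (simp add: indicator_def if_distrib[where f = "\<lambda>c. c * _"] cong: if_cong)
  have int: "integrable (p (fst x) (snd x)) (indicator (UNIV \<times> {z}) :: _ \<Rightarrow> real)" for z
    by (rule integrable_const_bound[where B = 1]) (auto simp: indicator_def)
  show "integrable (p (fst x) (snd x)) (\<lambda>y. g (snd y))"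
    unfolding * by (intro Bochner_Integration.integrable_sum integrable_mult_left int)
  show "(\<integral>y. g (snd y) \<partial>p (fst x) (snd x)) = (\<Sum>z\<in>UNIV. transition_prob p x z * g z)"
    unfolding * using int
    by (subst Bochner_Integration.integral_sum) (auto simp: transition_prob_def space_p)
qed

lemma transition_prob_nonneg: "0 \<le> transition_prob p x z"
  by (simp add: transition_prob_def)

lemma sum_transition_prob: "(\<Sum>z\<in>UNIV. transition_prob p x z) = 1"
  using integral_next_state(2)[of x "\<lambda>_. 1"] prob_space.prob_space[OF prob_space_p] by simp

lemma integral_step_kernel:
  assumes f [measurable]: "f \<in> borel_measurable step_space"
    and outer: "integrable (p y z) (\<lambda>(r, s'). \<Sum>b\<in>UNIV. pmf (\<pi> s') b * \<bar>f (r, s', b)\<bar>)"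
  shows "integrable (step_kernel p \<pi> (\<rho>, y, z)) f"
    and "(\<integral>w. f w \<partial>step_kernel p \<pi> (\<rho>, y, z))
      = (\<integral>(r, s'). (\<Sum>b\<in>UNIV. pmf (\<pi> s') b * f (r, s', b)) \<partial>p y z)"
proof -
  let ?N = "\<lambda>(r, s'). distr (measure_pmf (\<pi> s')) step_space (\<lambda>a'. (r, s', a'))"
  have draw: "(\<lambda>a'. (r, s', a')) \<in> measurable (measure_pmf (\<pi> s')) step_space" for r :: real and s'
    by (simp add: space_pair_measure)
  have "(\<lambda>x. distr (measure_pmf (\<pi> s')) step_space (\<lambda>a'. (fst x, s', a')))
      \<in> measurable (p y z) (prob_algebra step_space)" for s'
  proof (rule measurable_distr_prob_space2[OF measurable_const])
    show "measure_pmf (\<pi> s') \<in> space (prob_algebra (count_space UNIV))"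
      by (simp add: space_prob_algebra measure_pmf.prob_space_axioms)
  qed measurable
  from measurable_compose_countable[OF this, of snd]
  have N: "?N \<in> measurable (p y z) (subprob_algebra step_space)"
    unfolding split_beta' by (intro measurable_prob_algebraD) simp
  have inner_integral: "(\<integral>w. g w \<partial>?N v) = (\<Sum>b\<in>UNIV. pmf (\<pi> (snd v)) b * g (fst v, snd v, b))"
    if [measurable]: "g \<in> borel_measurable step_space" for g :: "real \<times> 's \<times> 'a \<Rightarrow> real" and v
  proof (cases v)
    case (Pair r s')
    have "(\<integral>w. g w \<partial>?N v) = (\<integral>b. g (r, s', b) \<partial>measure_pmf (\<pi> s'))"
      unfolding Pair prod.case by (rule integral_distr[OF draw that])
    also have "\<dots> = (\<Sum>b\<in>UNIV. pmf (\<pi> s') b * g (r, s', b))"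
      by (subst integral_measure_pmf[where A = UNIV]) auto
    finally show ?thesis by (simp add: Pair)
  qed
  have inner: "integrable (?N v) f" for v
  proof (cases v)
    case (Pair r s')
    have "integrable (measure_pmf (\<pi> s')) (\<lambda>b. f (r, s', b))"
      by (rule integrable_measure_pmf_finite) (rule finite)
    then show ?thesis
      unfolding Pair prod.case by (simp only: integrable_distr_eq[OF draw f])
  qed
  have "(\<integral>w. \<bar>f w\<bar> \<partial>?N v) = (\<Sum>b\<in>UNIV. pmf (\<pi> (snd v)) b * \<bar>f (fst v, snd v, b)\<bar>)" for v
    by (rule inner_integral) measurable
  then have "integrable (p y z) (\<lambda>v. \<integral>w. \<bar>f w\<bar> \<partial>?N v)"
    using outer[unfolded split_beta'] by presburger
  note bind = integral_bind_integrable[OF prob_space.not_empty[OF prob_space_p] f N inner this]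
  have step: "step_kernel p \<pi> (\<rho>, y, z) = p y z \<bind> ?N"
    by (simp add: step_kernel_def)
  show "integrable (step_kernel p \<pi> (\<rho>, y, z)) f"
    unfolding step by (rule bind(1))
  show "(\<integral>w. f w \<partial>step_kernel p \<pi> (\<rho>, y, z))
      = (\<integral>(r, s'). (\<Sum>b\<in>UNIV. pmf (\<pi> s') b * f (r, s', b)) \<partial>p y z)"
    unfolding step bind(2) split_beta'[of "\<lambda>r s'. \<Sum>b\<in>UNIV. pmf (\<pi> s') b * f (r, s', b)"]
    by (rule Bochner_Integration.integral_cong[OF refl]) (rule inner_integral[OF f])
qed

lemma integral_step_kernel_reward:
  assumes h [measurable]: "h \<in> borel_measurable borel" and int: "integrable (p y z) (\<lambda>v. h (fst v))"
  shows "integrable (step_kernel p \<pi> (\<rho>, y, z)) (\<lambda>w. h (fst w) :: real)"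
    and "(\<integral>w. h (fst w) \<partial>step_kernel p \<pi> (\<rho>, y, z)) = (\<integral>v. h (fst v) \<partial>p y z)"
proof -
  have sum: "(\<Sum>b\<in>UNIV. pmf (\<pi> s') b * c) = c" for s' and c :: real
    by (simp add: sum_pmf_eq_1 flip: sum_distrib_right)
  have "integrable (p y z) (\<lambda>v. \<bar>h (fst v)\<bar>)" using int by simp
  then have *: "integrable (p y z) (\<lambda>(r, s'). \<Sum>b\<in>UNIV. pmf (\<pi> s') b * \<bar>h (fst (r, s', b))\<bar>)"
    by (simp add: sum split_beta')
  have m: "(\<lambda>w. h (fst w)) \<in> borel_measurable step_space" by measurable
  show "integrable (step_kernel p \<pi> (\<rho>, y, z)) (\<lambda>w. h (fst w))"
    using integral_step_kernel(1)[OF m *] .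
  show "(\<integral>w. h (fst w) \<partial>step_kernel p \<pi> (\<rho>, y, z)) = (\<integral>v. h (fst v) \<partial>p y z)"
    using integral_step_kernel(2)[OF m *, of \<rho>] by (simp add: sum split_beta')
qed

lemma integral_step_kernel_state_action:
  shows "integrable (step_kernel p \<pi> (\<rho>, y, z)) (\<lambda>w. g (snd w) :: real)"
    and "(\<integral>w. g (snd w) \<partial>step_kernel p \<pi> (\<rho>, y, z)) = policy_average p \<pi> g (y, z)"
proof -
  have m: "(\<lambda>w. g (snd w)) \<in> borel_measurable step_space"
    by (rule measurable_state_action)
  have *: "integrable (p y z) (\<lambda>(r, s'). \<Sum>b\<in>UNIV. pmf (\<pi> s') b * \<bar>g (snd (r, s', b))\<bar>)"
    using integral_next_state(1)[of "(y, z)" "\<lambda>s'. \<Sum>b\<in>UNIV. pmf (\<pi> s') b * \<bar>g (s', b)\<bar>"]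
    by (simp add: split_beta')
  show "integrable (step_kernel p \<pi> (\<rho>, y, z)) (\<lambda>w. g (snd w))"
    using integral_step_kernel(1)[OF m *] .
  show "(\<integral>w. g (snd w) \<partial>step_kernel p \<pi> (\<rho>, y, z)) = policy_average p \<pi> g (y, z)"
    using integral_step_kernel(2)[OF m *, of \<rho>]
      integral_next_state(2)[of "(y, z)" "\<lambda>s'. \<Sum>b\<in>UNIV. pmf (\<pi> s') b * g (s', b)"]
    by (simp add: split_beta' policy_average_def)
qed

text \<open>
Restricting the Ionescu-Tulcea measure to its first \<open>n\<close> coordinates gives the composition of the first
\<open>n\<close> kernels, and from coordinate \<open>1\<close> on these look only at the preceding coordinate.  Hence the
one-dimensional marginals are those of a Markov chain.
\<close>

lemma trajectory_marginals:
  shows "sets (trajectory p \<pi> y z) = sets (\<Pi>\<^sub>M i\<in>UNIV. step_space)"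
    and "prob_space (trajectory p \<pi> y z)"
    and "distr (trajectory p \<pi> y z) step_space (\<lambda>\<omega>. \<omega> 0) = return step_space (0, y, z)"
    and "distr (trajectory p \<pi> y z) step_space (\<lambda>\<omega>. \<omega> (Suc n))
      = distr (trajectory p \<pi> y z) step_space (\<lambda>\<omega>. \<omega> n) \<bind> step_kernel p \<pi>"
proof -
  let ?S = "\<lambda>_::nat. step_space :: (real \<times> 's \<times> 'a) measure"
  interpret IT: Ionescu_Tulcea "trajectory_kernel p \<pi> y z" ?S
    by (rule Ionescu_Tulcea_trajectory_kernel[OF kernel])
  have lim: "trajectory p \<pi> y z = IT.PF.lim" by (simp add: trajectory_def)
  show sets: "sets (trajectory p \<pi> y z) = sets (\<Pi>\<^sub>M i\<in>UNIV. step_space)"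
    unfolding lim by (rule IT.PF.sets_lim)
  note [measurable_cong] = sets
  let ?u = "\<lambda>_. undefined :: real \<times> 's \<times> 'a"
  have u: "?u \<in> space (PiM {0..<0} ?S)" by (simp add: space_PiM)
  have sets_C: "sets (IT.C 0 n ?u) = sets (PiM {0..<n} ?S)" for n using IT.sets_C[OF u, of n] by simp
  have CI: "IT.CI {0..<n} = IT.C 0 n ?u" for n
  proof (rule measure_eqI)
    fix A assume "A \<in> sets (IT.CI {0..<n})"
    then have A: "A \<in> sets (PiM {0..<n} ?S)" by (simp add: IT.CI_def)
    then show "emeasure (IT.CI {0..<n}) A = emeasure (IT.C 0 n ?u) A"
      using sets.sets_into_space[OF A]
      by (subst IT.emeasure_CI[of _ n]) (auto simp: prod_emb_id space_PiM)
  qed (simp add: IT.CI_def sets_C)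
  have restrict: "distr (trajectory p \<pi> y z) (PiM {0..<n} ?S) (\<lambda>x. restrict x {0..<n}) = IT.C 0 n ?u" for n
    unfolding lim using IT.distr_lim[of "{0..<n}"] by (simp add: CI)
  have marginal: "distr (trajectory p \<pi> y z) step_space (\<lambda>\<omega>. \<omega> n)
      = distr (IT.C 0 (Suc n) ?u) step_space (\<lambda>\<omega>. \<omega> n)" for n
    unfolding restrict[symmetric]
    by (subst distr_distr) (auto simp: comp_def intro!: measurable_restrict)
  show "prob_space (trajectory p \<pi> y z)"
  proof (rule prob_space_distrD)
    show "(\<lambda>x. restrict x {0..<0}) \<in> measurable (trajectory p \<pi> y z) (PiM {0..<0} ?S)" by measurable
    show "prob_space (distr (trajectory p \<pi> y z) (PiM {0..<0} ?S) (\<lambda>x. restrict x {0..<0}))"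
      unfolding restrict by (rule IT.prob_space_C[OF u])
  qed
  have step: "distr (trajectory p \<pi> y z) step_space (\<lambda>\<omega>. \<omega> n)
      = IT.C 0 n ?u \<bind> trajectory_kernel p \<pi> y z n" for n
  proof -
    have ne: "space (IT.C 0 n ?u) \<noteq> {}"
      using prob_space.not_empty[OF IT.prob_space_C[OF u]] .
    have eP: "IT.eP n \<in> measurable (IT.C 0 n ?u) (subprob_algebra (PiM {0..<Suc n} ?S))"
      using IT.measurable_eP[of n] by (simp add: measurable_cong_sets[OF sets_C refl])
    have "distr (IT.C 0 (Suc n) ?u) step_space (\<lambda>\<omega>. \<omega> n)
        = IT.C 0 n ?u \<bind> (\<lambda>\<omega>. distr (IT.eP n \<omega>) step_space (\<lambda>\<omega>. \<omega> n))"
      by (simp add: distr_bind[OF eP ne])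
    also have "\<dots> = IT.C 0 n ?u \<bind> trajectory_kernel p \<pi> y z n"
    proof (rule bind_cong[OF refl])
      fix \<omega> assume "\<omega> \<in> space (IT.C 0 n ?u)"
      then have \<omega>: "\<omega> \<in> space (PiM {0..<n} ?S)" using IT.space_C[OF u, of n] by simp
      have upd: "fun_upd \<omega> n \<in> measurable (trajectory_kernel p \<pi> y z n \<omega>) (PiM {0..<Suc n} ?S)"
        using \<omega> IT.sets_P[OF \<omega>]
        by (intro measurable_fun_upd[where J = "{0..<n}"]) (auto simp: atLeastLessThanSuc cong: measurable_cong_sets)
      have "distr (IT.eP n \<omega>) step_space (\<lambda>\<omega>. \<omega> n)
          = distr (trajectory_kernel p \<pi> y z n \<omega>) step_space (\<lambda>v. v)"
        unfolding IT.eP_def by (subst distr_distr[OF _ upd]) (auto simp: comp_def)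
      also have "\<dots> = trajectory_kernel p \<pi> y z n \<omega>" by (rule distr_id2) (simp add: IT.sets_P[OF \<omega>])
      finally show "distr (IT.eP n \<omega>) step_space (\<lambda>\<omega>. \<omega> n) = trajectory_kernel p \<pi> y z n \<omega>" .
    qed
    finally show ?thesis by (simp add: marginal)
  qed
  show "distr (trajectory p \<pi> y z) step_space (\<lambda>\<omega>. \<omega> 0) = return step_space (0, y, z)"
    using bind_return[OF IT.P[of 0] u] by (simp add: step trajectory_kernel_def)
  show "distr (trajectory p \<pi> y z) step_space (\<lambda>\<omega>. \<omega> (Suc n))
      = distr (trajectory p \<pi> y z) step_space (\<lambda>\<omega>. \<omega> n) \<bind> step_kernel p \<pi>"
  proof -
    have ne: "space (IT.C 0 (Suc n) ?u) \<noteq> {}"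
      using prob_space.not_empty[OF IT.prob_space_C[OF u]] .
    have "(\<lambda>\<omega>. \<omega> n) \<in> measurable (IT.C 0 (Suc n) ?u) step_space"
      unfolding measurable_cong_sets[OF sets_C refl] by (rule measurable_component_singleton) simp
    from bind_distr[OF this measurable_prob_algebraD[OF measurable_step_kernel[OF kernel]] ne]
    have "distr (trajectory p \<pi> y z) step_space (\<lambda>\<omega>. \<omega> n) \<bind> step_kernel p \<pi>
        = IT.C 0 (Suc n) ?u \<bind> (\<lambda>\<omega>. step_kernel p \<pi> (\<omega> n))"
      unfolding marginal .
    then show ?thesis by (simp add: step[of "Suc n"] trajectory_kernel_def[abs_def] del: IT.C.simps)
  qed
qed

text \<open>
One step of the chain.  The conditional mean \<open>G\<close> depends only on a state-action pair; it therefore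
takes finitely many values, and so does the conditional mean \<open>G'\<close> of the absolute value, which yields
integrability.
\<close>

lemma integral_trajectory_Suc:
  fixes f :: "real \<times> 's \<times> 'a \<Rightarrow> real" and G :: "'s \<times> 'a \<Rightarrow> real"
  assumes f [measurable]: "f \<in> borel_measurable step_space"
    and int: "\<And>\<rho> y z. integrable (step_kernel p \<pi> (\<rho>, y, z)) f"
    and G: "\<And>\<rho> y z. (\<integral>w. f w \<partial>step_kernel p \<pi> (\<rho>, y, z)) = G (y, z)"
    and abs_G: "\<And>\<rho> y z. (\<integral>w. \<bar>f w\<bar> \<partial>step_kernel p \<pi> (\<rho>, y, z)) = G' (y, z)"
  shows "integrable (trajectory p \<pi> y z) (\<lambda>\<omega>. f (\<omega> (Suc n)))"
    and "(\<integral>\<omega>. f (\<omega> (Suc n)) \<partial>trajectory p \<pi> y z) = (\<integral>\<omega>. G (snd (\<omega> n)) \<partial>trajectory p \<pi> y z)"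
proof -
  note [measurable_cong] = trajectory_marginals(1)
  interpret T: prob_space "trajectory p \<pi> y z" by (rule trajectory_marginals(2))
  have comp [measurable]: "(\<lambda>\<omega>. \<omega> n) \<in> measurable (trajectory p \<pi> y z) step_space" for n
    by (simp add: measurable_cong_sets[OF trajectory_marginals(1) refl] measurable_component_singleton)
  have g_m [measurable]: "(\<lambda>w. g (snd w)) \<in> borel_measurable step_space" for g :: "'s \<times> 'a \<Rightarrow> real"
    by (rule measurable_state_action)
  let ?D = "distr (trajectory p \<pi> y z) step_space (\<lambda>\<omega>. \<omega> n)"
  have step: "step_kernel p \<pi> \<in> measurable ?D (subprob_algebra step_space)"
    using measurable_prob_algebraD[OF measurable_step_kernel[OF kernel]] by simp
  interpret D: prob_space ?D by (rule T.prob_space_distr) measurable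
  have G_v: "(\<integral>w. f w \<partial>step_kernel p \<pi> v) = G (snd v)"
    "(\<integral>w. \<bar>f w\<bar> \<partial>step_kernel p \<pi> v) = G' (snd v)" "integrable (step_kernel p \<pi> v) f" for v
    using G abs_G int by (cases v; auto)+
  have "integrable ?D (\<lambda>v. G' (snd v))"
  proof (rule D.integrable_const_bound)
    show "AE v in ?D. norm (G' (snd v)) \<le> W_norm G'"
      unfolding real_norm_def by (intro AE_I2 abs_le_W_norm)
  qed (simp add: measurable_state_action)
  then have "integrable ?D (\<lambda>v. \<integral>w. \<bar>f w\<bar> \<partial>step_kernel p \<pi> v)" by (simp add: G_v)
  note bind = integral_bind_integrable[OF D.not_empty f step G_v(3) this, folded trajectory_marginals(4)]
  show "integrable (trajectory p \<pi> y z) (\<lambda>\<omega>. f (\<omega> (Suc n)))"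
    using bind(1) by (subst (asm) integrable_distr_eq) auto
  show "(\<integral>\<omega>. f (\<omega> (Suc n)) \<partial>trajectory p \<pi> y z) = (\<integral>\<omega>. G (snd (\<omega> n)) \<partial>trajectory p \<pi> y z)"
    using bind(2) by (simp add: integral_distr G_v)
qed

section \<open>The Bellman equations\<close>

lemma abs_policy_average_le:
  assumes "\<And>y. \<bar>g y\<bar> \<le> d"
  shows "\<bar>policy_average p \<pi> g x\<bar> \<le> d"
proof -
  have "\<bar>\<Sum>b\<in>UNIV. pmf (\<pi> z) b * g (z, b)\<bar> \<le> d" for z
  proof -
    have "\<bar>\<Sum>b\<in>UNIV. pmf (\<pi> z) b * g (z, b)\<bar> \<le> (\<Sum>b\<in>UNIV. pmf (\<pi> z) b * d)"
      by (intro order_trans[OF sum_abs] sum_mono) (simp add: abs_mult assms mult_left_mono)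
    then show ?thesis by (simp add: sum_pmf_eq_1 flip: sum_distrib_right)
  qed
  then have "\<bar>policy_average p \<pi> g x\<bar> \<le> (\<Sum>z\<in>UNIV. transition_prob p x z * d)"
    unfolding policy_average_def
    by (intro order_trans[OF sum_abs] sum_mono)
      (simp add: abs_mult transition_prob_nonneg mult_left_mono)
  then show ?thesis by (simp add: sum_transition_prob flip: sum_distrib_right)
qed

lemma policy_average_mono:
  assumes "\<And>y. g y \<le> g' y"
  shows "policy_average p \<pi> g x \<le> policy_average p \<pi> g' x"
  unfolding policy_average_def
  by (intro sum_mono mult_left_mono assms transition_prob_nonneg pmf_nonneg)

lemma policy_average_diff:
  "policy_average p \<pi> (\<lambda>y. g y - g' y) x = policy_average p \<pi> g x - policy_average p \<pi> g' x"
  by (simp add: policy_average_def right_diff_distrib sum_subtractf)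

lemma policy_average_const: "policy_average p \<pi> (\<lambda>_. c) x = c"
  by (simp add: policy_average_def sum_pmf_eq_1 sum_transition_prob flip: sum_distrib_right)

lemma integral_trajectory_state_action:
  "(\<integral>\<omega>. g (snd (\<omega> n)) \<partial>trajectory p \<pi> y z) = (policy_average p \<pi> ^^ n) g (y, z)"
proof (induction n arbitrary: g)
  case 0
  have g: "(\<lambda>w. g (snd w)) \<in> borel_measurable step_space" by (rule measurable_state_action)
  have comp: "(\<lambda>\<omega>. \<omega> 0) \<in> measurable (trajectory p \<pi> y z) step_space"
    by (simp add: measurable_cong_sets[OF trajectory_marginals(1) refl] measurable_component_singleton)
  have "(\<integral>\<omega>. g (snd (\<omega> 0)) \<partial>trajectory p \<pi> y z) = (\<integral>v. g (snd v) \<partial>return step_space (0, y, z))"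
    unfolding trajectory_marginals(3)[of \<pi> y z, symmetric] by (rule integral_distr[OF comp g, symmetric])
  also have "\<dots> = g (y, z)"
    using integral_return[OF _ g, of "(0, y, z)"] by (simp add: space_pair_measure)
  finally show ?case by simp
next
  case (Suc n)
  have "(\<integral>\<omega>. g (snd (\<omega> (Suc n))) \<partial>trajectory p \<pi> y z)
      = (\<integral>\<omega>. policy_average p \<pi> g (snd (\<omega> n)) \<partial>trajectory p \<pi> y z)"
    by (rule integral_trajectory_Suc(2)[where f = "\<lambda>w. g (snd w)"
          and G' = "policy_average p \<pi> (\<lambda>y. \<bar>g y\<bar>)"])
      (simp_all add: measurable_state_action integral_step_kernel_state_action
        integral_step_kernel_state_action(2)[where g = "\<lambda>y. \<bar>g y\<bar>"])
  also have "\<dots> = (policy_average p \<pi> ^^ Suc n) g (y, z)"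
    by (simp add: Suc funpow_swap1)
  finally show ?case .
qed

lemma integral_trajectory_reward:
  shows "integrable (trajectory p \<pi> y z) (\<lambda>\<omega>. fst (\<omega> (Suc n)))"
    and "(\<integral>\<omega>. fst (\<omega> (Suc n)) \<partial>trajectory p \<pi> y z)
      = (policy_average p \<pi> ^^ n) (expected_reward p) (y, z)"
    and "(\<integral>\<omega>. \<bar>fst (\<omega> (Suc n))\<bar> \<partial>trajectory p \<pi> y z)
      \<le> W_norm (\<lambda>x. \<integral>v. \<bar>fst v\<bar> \<partial>p (fst x) (snd x))"
proof -
  define A where "A x = (\<integral>v. \<bar>fst v\<bar> \<partial>p (fst x) (snd x))" for x
  have abs_reward: "integrable (p y z) (\<lambda>v. \<bar>fst v\<bar>)" for y z using integrable_reward by simp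
  note kernel_id = integral_step_kernel_reward[where h = "\<lambda>x. x", OF _ integrable_reward, simplified]
  note kernel_abs = integral_step_kernel_reward[where h = abs, OF _ abs_reward, simplified]
  have id: "integrable (trajectory p \<pi> y z) (\<lambda>\<omega>. fst (\<omega> (Suc n)))"
    "(\<integral>\<omega>. fst (\<omega> (Suc n)) \<partial>trajectory p \<pi> y z)
      = (\<integral>\<omega>. expected_reward p (snd (\<omega> n)) \<partial>trajectory p \<pi> y z)"
    by (rule integral_trajectory_Suc[where f = fst and G' = A and G = "expected_reward p"];
        simp add: kernel_id kernel_abs A_def expected_reward_def)+
  show "integrable (trajectory p \<pi> y z) (\<lambda>\<omega>. fst (\<omega> (Suc n)))" by (rule id)
  show "(\<integral>\<omega>. fst (\<omega> (Suc n)) \<partial>trajectory p \<pi> y z)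
      = (policy_average p \<pi> ^^ n) (expected_reward p) (y, z)"
    unfolding id(2) by (rule integral_trajectory_state_action)
  have "(\<integral>\<omega>. \<bar>fst (\<omega> (Suc n))\<bar> \<partial>trajectory p \<pi> y z)
      = (\<integral>\<omega>. A (snd (\<omega> n)) \<partial>trajectory p \<pi> y z)"
    by (rule integral_trajectory_Suc(2)[where f = "\<lambda>w. \<bar>fst w\<bar>" and G' = A])
      (simp_all add: kernel_abs A_def)
  also have "\<dots> = (policy_average p \<pi> ^^ n) A (y, z)" by (rule integral_trajectory_state_action)
  also have "\<dots> \<le> W_norm A"
  proof -
    have "\<bar>(policy_average p \<pi> ^^ n) A x\<bar> \<le> W_norm A" for x
    proof (induction n arbitrary: x)
      case 0
      show ?case using abs_le_W_norm[of A x] by simp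
    next
      case (Suc n)
      show ?case using abs_policy_average_le[OF Suc] by simp
    qed
    then show ?thesis by (meson abs_le_D1)
  qed
  finally show "(\<integral>\<omega>. \<bar>fst (\<omega> (Suc n))\<bar> \<partial>trajectory p \<pi> y z)
      \<le> W_norm (\<lambda>x. \<integral>v. \<bar>fst v\<bar> \<partial>p (fst x) (snd x))"
    by (simp add: A_def[abs_def])
qed

text \<open>
The mean reward at time \<open>n\<close> is the \<open>n\<close>-th iterate of the transition operator applied to the mean
rewards.  The absolute first moments of the rewards are bounded uniformly in time, so that discounting
allows the expectation to be taken term by term.
\<close>

lemma Q_value_series:
  assumes \<gamma>: "0 < \<gamma>" "\<gamma> < 1"
  shows "(\<lambda>n. \<gamma> ^ n * (policy_average p \<pi> ^^ n) (expected_reward p) x) sums Q_value p \<gamma> \<pi> x"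
proof (cases x)
  case (Pair y z)
  let ?T = "trajectory p \<pi> y z"
  let ?f = "\<lambda>n \<omega>. \<gamma> ^ n * fst (\<omega> (Suc n)) :: real"
  define B where "B = W_norm (\<lambda>x. \<integral>v. \<bar>fst v\<bar> \<partial>p (fst x) (snd x))"
  have int: "integrable ?T (?f n)" for n
    using integral_trajectory_reward(1) by (rule integrable_mult_right)
  have norm_int: "(\<integral>\<omega>. norm (?f n \<omega>) \<partial>?T) \<le> \<gamma> ^ n * B" for n
    using integral_trajectory_reward(3)[of \<pi> y z n] \<gamma> by (simp add: B_def abs_mult)
  have geometric: "summable (\<lambda>n. \<gamma> ^ n * B)" using \<gamma> by (intro summable_mult2 summable_geometric) auto
  then have sum_int: "summable (\<lambda>n. \<integral>\<omega>. norm (?f n \<omega>) \<partial>?T)"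
    by (rule summable_comparison_test'[where N = 0]) (use norm_int in auto)
  have "AE \<omega> in ?T. summable (\<lambda>n. norm (?f n \<omega>))"
  proof -
    have m [measurable]: "?f n \<in> borel_measurable ?T" for n using int by (rule borel_measurable_integrable)
    have "(\<integral>\<^sup>+\<omega>. (\<Sum>n. ennreal (norm (?f n \<omega>))) \<partial>?T) = (\<Sum>n. \<integral>\<^sup>+\<omega>. ennreal (norm (?f n \<omega>)) \<partial>?T)"
      by (rule nn_integral_suminf) measurable
    also have "\<dots> = (\<Sum>n. ennreal (\<integral>\<omega>. norm (?f n \<omega>) \<partial>?T))"
      by (intro suminf_cong nn_integral_eq_integral integrable_norm int) simp
    also have "\<dots> \<noteq> \<infinity>" using sum_int by (simp add: ennreal_suminf_neq_top)
    finally have "AE \<omega> in ?T. (\<Sum>n. ennreal (norm (?f n \<omega>))) \<noteq> \<infinity>"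
      by (intro nn_integral_PInf_AE) measurable
    then show ?thesis
      by (rule AE_mp) (auto intro!: AE_I2 summable_suminf_not_top)
  qed
  from sums_integral[OF int this sum_int]
  show ?thesis
    by (simp add: Pair Q_value_def integral_trajectory_reward(2))
qed

lemma Q_value_Bellman:
  assumes \<gamma>: "0 < \<gamma>" "\<gamma> < 1"
  shows "Q_value p \<gamma> \<pi> x = expected_reward p x + \<gamma> * policy_average p \<pi> (Q_value p \<gamma> \<pi>) x"
proof (rule sums_unique2)
  let ?t = "\<lambda>n. \<gamma> ^ n * (policy_average p \<pi> ^^ n) (expected_reward p) x"
  show "?t sums Q_value p \<gamma> \<pi> x" by (rule Q_value_series[OF \<gamma>])
  have expand: "(\<lambda>n. policy_average p \<pi> (\<lambda>y. \<gamma> ^ n * (policy_average p \<pi> ^^ n) (expected_reward p) y) x)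
      sums policy_average p \<pi> (Q_value p \<gamma> \<pi>) x"
    unfolding policy_average_def[of _ _ _ x] by (intro sums_sum sums_mult Q_value_series[OF \<gamma>])
  have scale: "\<gamma> * policy_average p \<pi> (\<lambda>y. \<gamma> ^ n * (policy_average p \<pi> ^^ n) (expected_reward p) y) x
      = ?t (Suc n)" for n
    by (simp add: policy_average_def[of _ _ _ x] sum_distrib_left mult_ac)
  have "(\<lambda>n. ?t (Suc n)) sums (\<gamma> * policy_average p \<pi> (Q_value p \<gamma> \<pi>) x)"
    using sums_mult[OF expand, of \<gamma>] unfolding scale .
  from sums_Suc[OF this] show "?t sums (expected_reward p x + \<gamma> * policy_average p \<pi> (Q_value p \<gamma> \<pi>) x)"
    by (simp add: add.commute)
qed

text \<open>
The difference of two solutions of the evaluation equation is a fixed point of \<open>\<gamma>\<close> times an averaging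
operator, hence zero.
\<close>

lemma Q_value_unique:
  assumes \<gamma>: "0 < \<gamma>" "\<gamma> < 1"
    and q: "\<And>x. q x = expected_reward p x + \<gamma> * policy_average p \<pi> q x"
  shows "Q_value p \<gamma> \<pi> = q"
proof
  fix x
  define d where "d y = Q_value p \<gamma> \<pi> y - q y" for y
  have "d y = \<gamma> * policy_average p \<pi> d y" for y
    using Q_value_Bellman[OF \<gamma>, of \<pi> y] q[of y]
    by (simp add: d_def[abs_def] policy_average_diff algebra_simps)
  moreover have "\<bar>policy_average p \<pi> d y\<bar> \<le> W_norm d" for y
    by (intro abs_policy_average_le abs_le_W_norm)
  ultimately have "\<bar>d y\<bar> \<le> \<gamma> * W_norm d" for y
    using \<gamma> by (metis abs_mult abs_of_pos mult_left_mono less_imp_le)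
  then have "W_norm d \<le> \<gamma> * W_norm d" by (simp add: W_norm_le_iff)
  then have "W_norm d \<le> 0" using \<gamma> by (simp add: mult_le_cancel_right1)
  then show "Q_value p \<gamma> \<pi> x = q x" using abs_le_W_norm[of d x] by (simp add: d_def)
qed

lemma greedy_sum:
  fixes q :: "'s \<times> 'a \<Rightarrow> real"
  assumes "pmf \<mu> b = 1" "\<And>b'. q (z, b') \<le> q (z, b)"
  shows "(\<Sum>b\<in>UNIV. pmf \<mu> b * q (z, b)) = (MAX b. q (z, b))"
proof -
  have "(\<Sum>b'\<in>UNIV - {b}. pmf \<mu> b') = 0"
    using sum_pmf_eq_1[of UNIV \<mu>] assms(1) by (simp add: sum.remove[of UNIV b])
  then have "pmf \<mu> b' = 0" if "b' \<noteq> b" for b'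
    using that by (subst (asm) sum_nonneg_eq_0_iff) auto
  then have "(\<Sum>b\<in>UNIV. pmf \<mu> b * q (z, b)) = q (z, b)"
    using assms(1) by (subst sum.remove[of UNIV b]) auto
  also have "\<dots> = (MAX b. q (z, b))"
    by (rule Max_eqI[symmetric]) (use assms(2) in auto)
  finally show ?thesis .
qed

text \<open>
For a policy that is greedy with respect to its own values, the average over its actions is the
maximum over all actions, and the evaluation equation becomes the optimality equation.
\<close>

lemma optimal_policy_Bellman:
  assumes \<gamma>: "0 < \<gamma>" "\<gamma> < 1" and opt: "optimal_policy p \<gamma> \<pi>"
  shows "bellman (expected_reward p) (transition_prob p) \<gamma> (Q_value p \<gamma> \<pi>) = Q_value p \<gamma> \<pi>"
proof
  fix x
  have "(\<Sum>b\<in>UNIV. pmf (\<pi> z) b * Q_value p \<gamma> \<pi> (z, b)) = (MAX b. Q_value p \<gamma> \<pi> (z, b))" for z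
  proof -
    obtain b where "pmf (\<pi> z) b = 1" "\<And>b'. Q_value p \<gamma> \<pi> (z, b') \<le> Q_value p \<gamma> \<pi> (z, b)"
      using opt unfolding optimal_policy_def by blast
    then show ?thesis by (rule greedy_sum)
  qed
  then show "bellman (expected_reward p) (transition_prob p) \<gamma> (Q_value p \<gamma> \<pi>) x = Q_value p \<gamma> \<pi> x"
    using Q_value_Bellman[OF \<gamma>, of \<pi> x] by (simp add: bellman_def policy_average_def)
qed

lemma sum_pmf_le_Max: "(\<Sum>b\<in>UNIV. pmf \<mu> b * q (z, b)) \<le> (MAX b. q (z, b) :: real)"
  for q :: "'s \<times> 'a \<Rightarrow> real"
proof -
  have "(\<Sum>b\<in>UNIV. pmf \<mu> b * q (z, b)) \<le> (\<Sum>b\<in>UNIV. pmf \<mu> b * (MAX b. q (z, b)))"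
    by (intro sum_mono mult_left_mono Max_ge) auto
  then show ?thesis by (simp add: sum_pmf_eq_1 flip: sum_distrib_right)
qed

text \<open>
Averaging over actions never exceeds maximizing over them, so the largest excess \<open>D\<close> of the value of a
policy over the fixed point satisfies \<open>D \<le> \<gamma> D\<close>.
\<close>

lemma Q_value_le_Bellman_fixed_point:
  assumes \<gamma>: "0 < \<gamma>" "\<gamma> < 1"
    and q: "bellman (expected_reward p) (transition_prob p) \<gamma> q = q"
  shows "Q_value p \<gamma> \<pi> x \<le> q x"
proof -
  define d where "d y = Q_value p \<gamma> \<pi> y - q y" for y
  define D where "D = (MAX y. d y)"
  have d_le: "d y \<le> D" for y unfolding D_def by (rule Max_ge) auto
  have "d y \<le> \<gamma> * D" for y
  proof -
    have "policy_average p \<pi> q y \<le> (\<Sum>z\<in>UNIV. transition_prob p y z * (MAX b. q (z, b)))"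
      unfolding policy_average_def by (intro sum_mono mult_left_mono sum_pmf_le_Max transition_prob_nonneg)
    then have "\<gamma> * policy_average p \<pi> q y \<le> \<gamma> * (\<Sum>z\<in>UNIV. transition_prob p y z * (MAX b. q (z, b)))"
      using \<gamma> by simp
    moreover have "q y = expected_reward p y + \<gamma> * (\<Sum>z\<in>UNIV. transition_prob p y z * (MAX b. q (z, b)))"
      using fun_cong[OF q, of y] by (simp add: bellman_def)
    ultimately have "d y \<le> \<gamma> * policy_average p \<pi> (Q_value p \<gamma> \<pi>) y - \<gamma> * policy_average p \<pi> q y"
      using Q_value_Bellman[OF \<gamma>, of \<pi> y] unfolding d_def by linarith
    also have "\<dots> = \<gamma> * policy_average p \<pi> d y"
      by (simp add: d_def[abs_def] policy_average_diff right_diff_distrib)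
    also have "\<dots> \<le> \<gamma> * policy_average p \<pi> (\<lambda>_. D) y"
      using \<gamma> by (intro mult_left_mono policy_average_mono d_le) auto
    finally show ?thesis by (simp add: policy_average_const)
  qed
  moreover have "D \<in> range d" unfolding D_def by (rule Max_in) auto
  ultimately have "D \<le> \<gamma> * D" by auto
  then have "(1 - \<gamma>) * D \<le> 0" by (simp add: algebra_simps)
  then have "D \<le> 0" using \<gamma> by (simp add: mult_le_0_iff)
  then show ?thesis using d_le[of x] by (simp add: d_def)
qed

text \<open>
A deterministic policy that is greedy for a fixed point of the Bellman operator has this fixed point
as its value.
\<close>

lemma optimal_policy_exists:
  assumes \<gamma>: "0 < \<gamma>" "\<gamma> < 1"
  shows "\<exists>\<pi>. optimal_policy p \<gamma> \<pi>"
proof -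
  have "\<exists>q. bellman (expected_reward p) (transition_prob p) \<gamma> q = q"
    by (rule bellman_fixed_point_exists) (use \<gamma> transition_prob_nonneg sum_transition_prob in auto)
  then obtain q where q: "bellman (expected_reward p) (transition_prob p) \<gamma> q = q" ..
  have "\<exists>b. \<forall>b'. q (z, b') \<le> q (z, b)" for z
  proof -
    have "(MAX b. q (z, b)) \<in> range (\<lambda>b. q (z, b))" by (rule Max_in) auto
    then obtain b where "(MAX b. q (z, b)) = q (z, b)" by (rule rangeE)
    moreover have "q (z, b') \<le> (MAX b. q (z, b))" for b' by (rule Max_ge) auto
    ultimately show ?thesis by metis
  qed
  then obtain act where act: "\<And>z b'. q (z, b') \<le> q (z, act z)" by metis
  define \<pi> where "\<pi> z = return_pmf (act z)" for z
  have greedy: "pmf (\<pi> z) (act z) = 1" for z by (simp add: \<pi>_def)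
  note max = greedy_sum[where q = q, OF greedy act]
  have Q: "Q_value p \<gamma> \<pi> = q"
  proof (rule Q_value_unique[OF \<gamma>])
    show "q x = expected_reward p x + \<gamma> * policy_average p \<pi> q x" for x
      using fun_cong[OF q, of x] by (simp add: bellman_def policy_average_def max)
  qed
  have "V_value p \<gamma> \<pi>' z \<le> V_value p \<gamma> \<pi> z" for \<pi>' z
  proof -
    have "V_value p \<gamma> \<pi>' z \<le> (\<Sum>b\<in>UNIV. pmf (\<pi>' z) b * q (z, b))"
      unfolding V_value_def
      by (intro sum_mono mult_left_mono Q_value_le_Bellman_fixed_point[OF \<gamma> q]) auto
    also have "\<dots> \<le> (MAX b. q (z, b))" by (rule sum_pmf_le_Max)
    also have "\<dots> = V_value p \<gamma> \<pi> z" by (simp add: V_value_def Q max)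
    finally show ?thesis .
  qed
  then have "optimal_policy p \<gamma> \<pi>"
    unfolding optimal_policy_def Q using greedy act by blast
  then show ?thesis by (rule exI[of "optimal_policy p \<gamma>"])
qed

text \<open>
The choice of an optimal policy in the definition of \<^const>\<open>Q_star\<close> is harmless: every optimal policy
satisfies the optimality equation.
\<close>

lemma Q_star_Bellman:
  assumes "0 < \<gamma>" "\<gamma> < 1"
  shows "bellman (expected_reward p) (transition_prob p) \<gamma> (Q_star p \<gamma>) = Q_star p \<gamma>"
  unfolding Q_star_def
  using optimal_policy_Bellman[OF assms someI_ex[OF optimal_policy_exists[OF assms]]] .

end

section \<open>Convergence of square-summable martingale differences\<close>

lemma integrable_product_of_squares:
  fixes f g :: "'w \<Rightarrow> real"
  assumes [measurable]: "f \<in> borel_measurable M" "g \<in> borel_measurable M"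
    and "integrable M (\<lambda>\<omega>. (f \<omega>)\<^sup>2)" "integrable M (\<lambda>\<omega>. (g \<omega>)\<^sup>2)"
  shows "integrable M (\<lambda>\<omega>. f \<omega> * g \<omega>)"
proof (rule Bochner_Integration.integrable_bound)
  show "integrable M (\<lambda>\<omega>. (f \<omega>)\<^sup>2 + (g \<omega>)\<^sup>2)" using assms by simp
  show "AE \<omega> in M. norm (f \<omega> * g \<omega>) \<le> norm ((f \<omega>)\<^sup>2 + (g \<omega>)\<^sup>2)"
  proof (rule AE_I2)
    fix \<omega>
    have "0 \<le> (\<bar>f \<omega>\<bar> - \<bar>g \<omega>\<bar>)\<^sup>2" "0 \<le> \<bar>f \<omega>\<bar> * \<bar>g \<omega>\<bar>" by auto
    then have "\<bar>f \<omega>\<bar> * \<bar>g \<omega>\<bar> \<le> (f \<omega>)\<^sup>2 + (g \<omega>)\<^sup>2"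
      unfolding power2_diff power2_abs by linarith
    then show "norm (f \<omega> * g \<omega>) \<le> norm ((f \<omega>)\<^sup>2 + (g \<omega>)\<^sup>2)" by (simp add: abs_mult)
  qed
qed simp

text \<open>
Conditional expectations appear only through orthogonality: an increment has mean zero against every
square-integrable function of the past.
\<close>

locale martingale_differences = prob_space M for M :: "'w measure" +
  fixes F :: "nat \<Rightarrow> 'w measure" and X :: "nat \<Rightarrow> 'w \<Rightarrow> real"
  assumes subalgebra: "subalgebra M (F n)"
    and filtration: "sets (F n) \<subseteq> sets (F (Suc n))"
    and adapted: "X n \<in> borel_measurable (F (Suc n))"
    and square_integrable: "integrable M (\<lambda>\<omega>. (X n \<omega>)\<^sup>2)"
    and orthogonal: "g \<in> borel_measurable (F n) \<Longrightarrow> integrable M (\<lambda>\<omega>. (g \<omega>)\<^sup>2) \<Longrightarrow>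
          (\<integral>\<omega>. g \<omega> * X n \<omega> \<partial>M) = 0"
begin

lemma space_F: "space (F n) = space M"
  using subalgebra[of n] by (simp add: subalgebra_def)

lemma sets_F_mono: "m \<le> n \<Longrightarrow> sets (F m) \<subseteq> sets (F n)"
  using filtration by (rule lift_Suc_mono_le)

lemma measurable_F_mono: "m \<le> n \<Longrightarrow> g \<in> borel_measurable (F m) \<Longrightarrow> g \<in> borel_measurable (F n)"
  using sets_F_mono[of m n] by (auto simp: measurable_def space_F)

lemma measurable_F_M: "g \<in> borel_measurable (F n) \<Longrightarrow> g \<in> borel_measurable M"
  using measurable_from_subalg[OF subalgebra] .

lemma measurable_X [measurable]: "X n \<in> borel_measurable M"
  using measurable_F_M[OF adapted] .

definition partial_sum :: "nat \<Rightarrow> nat \<Rightarrow> 'w \<Rightarrow> real" where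
  "partial_sum m k \<omega> = (\<Sum>i<k. X (m + i) \<omega>)"

text \<open>
The partial sums stopped as soon as they leave the interval from \<open>- \<epsilon>\<close> to \<open>\<epsilon>\<close>.  They turn the
event that some partial sum is large into the event that the last stopped sum is large.
\<close>

primrec stopped_sum :: "real \<Rightarrow> nat \<Rightarrow> nat \<Rightarrow> 'w \<Rightarrow> real" where
  "stopped_sum \<epsilon> m 0 = (\<lambda>_. 0)"
| "stopped_sum \<epsilon> m (Suc k) = (\<lambda>\<omega>. if \<bar>stopped_sum \<epsilon> m k \<omega>\<bar> < \<epsilon>
      then stopped_sum \<epsilon> m k \<omega> + X (m + k) \<omega> else stopped_sum \<epsilon> m k \<omega>)"

lemma stopped_sum_adapted: "stopped_sum \<epsilon> m k \<in> borel_measurable (F (m + k))"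
proof (induction k)
  case (Suc k)
  have [measurable]: "stopped_sum \<epsilon> m k \<in> borel_measurable (F (Suc (m + k)))"
    "X (m + k) \<in> borel_measurable (F (Suc (m + k)))"
    using measurable_F_mono[OF _ Suc, of "Suc (m + k)"] adapted by simp_all
  show ?case by simp
qed simp

text \<open>
Whether the sum has been stopped before an increment is decided by the past, so the cross terms
vanish, and stopping can only discard squares.
\<close>

lemma stopped_sum_second_moment:
  "integrable M (\<lambda>\<omega>. (stopped_sum \<epsilon> m k \<omega>)\<^sup>2) \<and>
   (\<integral>\<omega>. (stopped_sum \<epsilon> m k \<omega>)\<^sup>2 \<partial>M) \<le> (\<Sum>i<k. \<integral>\<omega>. (X (m + i) \<omega>)\<^sup>2 \<partial>M)"
proof (induction k)
  case (Suc k)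
  define Z where "Z = stopped_sum \<epsilon> m k"
  define g where "g \<omega> = (if \<bar>Z \<omega>\<bar> < \<epsilon> then Z \<omega> else 0)" for \<omega>
  have Z_F: "Z \<in> borel_measurable (F (m + k))" unfolding Z_def by (rule stopped_sum_adapted)
  then have g_F: "g \<in> borel_measurable (F (m + k))" unfolding g_def by measurable
  have [measurable]: "Z \<in> borel_measurable M" "g \<in> borel_measurable M"
    using Z_F g_F by (auto intro: measurable_F_M)
  have Z2: "integrable M (\<lambda>\<omega>. (Z \<omega>)\<^sup>2)" using Suc by (simp add: Z_def)
  have g2: "integrable M (\<lambda>\<omega>. (g \<omega>)\<^sup>2)"
    by (rule Bochner_Integration.integrable_bound[OF Z2]) (auto simp: g_def)
  have X2: "integrable M (\<lambda>\<omega>. if \<bar>Z \<omega>\<bar> < \<epsilon> then (X (m + k) \<omega>)\<^sup>2 else 0)"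
    by (rule Bochner_Integration.integrable_bound[OF square_integrable[of "m + k"]]) auto
  have gX: "integrable M (\<lambda>\<omega>. g \<omega> * X (m + k) \<omega>)"
    by (intro integrable_product_of_squares g2 square_integrable) auto
  have square: "(stopped_sum \<epsilon> m (Suc k) \<omega>)\<^sup>2
      = (Z \<omega>)\<^sup>2 + 2 * (g \<omega> * X (m + k) \<omega>)
        + (if \<bar>Z \<omega>\<bar> < \<epsilon> then (X (m + k) \<omega>)\<^sup>2 else 0)" for \<omega>
    by (simp add: Z_def g_def power2_sum)
  have "(\<integral>\<omega>. (stopped_sum \<epsilon> m (Suc k) \<omega>)\<^sup>2 \<partial>M)
      = (\<integral>\<omega>. (Z \<omega>)\<^sup>2 \<partial>M) + (\<integral>\<omega>. (if \<bar>Z \<omega>\<bar> < \<epsilon> then (X (m + k) \<omega>)\<^sup>2 else 0) \<partial>M)"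
    unfolding square using Z2 gX X2 orthogonal[OF g_F g2] by simp
  also have "\<dots> \<le> (\<integral>\<omega>. (Z \<omega>)\<^sup>2 \<partial>M) + (\<integral>\<omega>. (X (m + k) \<omega>)\<^sup>2 \<partial>M)"
    by (intro add_left_mono integral_mono X2 square_integrable) auto
  also have "\<dots> \<le> (\<Sum>i<Suc k. \<integral>\<omega>. (X (m + i) \<omega>)\<^sup>2 \<partial>M)"
    using Suc by (simp add: Z_def)
  finally show ?case
    unfolding square using Z2 gX X2 by (auto simp del: sum.lessThan_Suc)
qed simp

lemma stopped_sum_eq_partial_sum:
  "(\<And>j. j < k \<Longrightarrow> \<bar>partial_sum m j \<omega>\<bar> < \<epsilon>) \<Longrightarrow> stopped_sum \<epsilon> m k \<omega> = partial_sum m k \<omega>"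
  by (induction k) (auto simp: partial_sum_def)

lemma stopped_sum_frozen:
  "j \<le> k \<Longrightarrow> \<epsilon> \<le> \<bar>stopped_sum \<epsilon> m j \<omega>\<bar> \<Longrightarrow> \<epsilon> \<le> \<bar>stopped_sum \<epsilon> m k \<omega>\<bar>"
  by (induction k rule: dec_induct) auto

lemma stopped_sum_crosses:
  assumes "j \<le> k" "\<epsilon> \<le> \<bar>partial_sum m j \<omega>\<bar>"
  shows "\<epsilon> \<le> \<bar>stopped_sum \<epsilon> m k \<omega>\<bar>"
proof -
  define i where "i = (LEAST i. \<epsilon> \<le> \<bar>partial_sum m i \<omega>\<bar>)"
  have i: "\<epsilon> \<le> \<bar>partial_sum m i \<omega>\<bar>" "i \<le> j"
    using assms(2) unfolding i_def by (auto intro: LeastI Least_le)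
  have "\<bar>partial_sum m l \<omega>\<bar> < \<epsilon>" if "l < i" for l
    using not_less_Least[OF that[unfolded i_def]] by simp
  then have "stopped_sum \<epsilon> m i \<omega> = partial_sum m i \<omega>" by (rule stopped_sum_eq_partial_sum)
  with i assms(1) show ?thesis by (intro stopped_sum_frozen[of i k]) auto
qed

lemma measurable_partial_sum [measurable]: "partial_sum m k \<in> borel_measurable M"
  unfolding partial_sum_def by measurable

text \<open>
Kolmogorov's inequality, obtained as Markov's inequality for the square of the stopped sum.
\<close>

lemma maximal_inequality:
  assumes "0 < \<epsilon>"
  shows "prob {\<omega> \<in> space M. \<exists>j\<le>k. \<epsilon> \<le> \<bar>partial_sum m j \<omega>\<bar>}
    \<le> (\<Sum>i<k. \<integral>\<omega>. (X (m + i) \<omega>)\<^sup>2 \<partial>M) / \<epsilon>\<^sup>2"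
proof -
  have [measurable]: "stopped_sum \<epsilon> m k \<in> borel_measurable M"
    using measurable_F_M[OF stopped_sum_adapted] .
  have "prob {\<omega> \<in> space M. \<exists>j\<le>k. \<epsilon> \<le> \<bar>partial_sum m j \<omega>\<bar>}
      \<le> prob {\<omega> \<in> space M. \<epsilon>\<^sup>2 \<le> (stopped_sum \<epsilon> m k \<omega>)\<^sup>2}"
  proof (rule finite_measure_mono)
    show "{\<omega> \<in> space M. \<exists>j\<le>k. \<epsilon> \<le> \<bar>partial_sum m j \<omega>\<bar>}
        \<subseteq> {\<omega> \<in> space M. \<epsilon>\<^sup>2 \<le> (stopped_sum \<epsilon> m k \<omega>)\<^sup>2}"
      using assms by (auto simp: abs_le_square_iff[symmetric] dest: stopped_sum_crosses)
  qed measurable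
  also have "\<dots> \<le> (\<integral>\<omega>. (stopped_sum \<epsilon> m k \<omega>)\<^sup>2 \<partial>M) / \<epsilon>\<^sup>2"
    using assms stopped_sum_second_moment
    by (intro integral_Markov_inequality_measure[where A = "{}"]) auto
  also have "\<dots> \<le> (\<Sum>i<k. \<integral>\<omega>. (X (m + i) \<omega>)\<^sup>2 \<partial>M) / \<epsilon>\<^sup>2"
    using stopped_sum_second_moment by (intro divide_right_mono) auto
  finally show ?thesis .
qed

lemma tail_maximal_inequality:
  assumes "0 < \<epsilon>" and sm: "summable (\<lambda>n. \<integral>\<omega>. (X n \<omega>)\<^sup>2 \<partial>M)"
  shows "prob {\<omega> \<in> space M. \<exists>j. \<epsilon> \<le> \<bar>partial_sum m j \<omega>\<bar>}
    \<le> (\<Sum>i. \<integral>\<omega>. (X (i + m) \<omega>)\<^sup>2 \<partial>M) / \<epsilon>\<^sup>2"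
proof (rule LIMSEQ_le_const2)
  let ?A = "\<lambda>k. {\<omega> \<in> space M. \<exists>j\<le>k. \<epsilon> \<le> \<bar>partial_sum m j \<omega>\<bar>}"
  have "(\<lambda>k. prob (?A k)) \<longlonglongrightarrow> prob (\<Union>k. ?A k)"
  proof (rule finite_Lim_measure_incseq)
    show "incseq ?A" by (auto simp: incseq_def intro: order_trans)
  qed auto
  moreover have "(\<Union>k. ?A k) = {\<omega> \<in> space M. \<exists>j. \<epsilon> \<le> \<bar>partial_sum m j \<omega>\<bar>}" by auto
  ultimately show "(\<lambda>k. prob (?A k)) \<longlonglongrightarrow> prob {\<omega> \<in> space M. \<exists>j. \<epsilon> \<le> \<bar>partial_sum m j \<omega>\<bar>}"
    by simp
  have "prob (?A k) \<le> (\<Sum>i. \<integral>\<omega>. (X (i + m) \<omega>)\<^sup>2 \<partial>M) / \<epsilon>\<^sup>2" for k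
  proof -
    have "(\<Sum>i<k. \<integral>\<omega>. (X (m + i) \<omega>)\<^sup>2 \<partial>M) \<le> (\<Sum>i. \<integral>\<omega>. (X (i + m) \<omega>)\<^sup>2 \<partial>M)"
      unfolding add.commute[of m]
      using summable_ignore_initial_segment[OF sm, of m] by (intro sum_le_suminf) auto
    with maximal_inequality[OF assms(1), of k m] show ?thesis
      by (meson divide_right_mono order_trans zero_le_power2)
  qed
  then show "\<exists>N. \<forall>n\<ge>N. prob (?A n) \<le> (\<Sum>i. \<integral>\<omega>. (X (i + m) \<omega>)\<^sup>2 \<partial>M) / \<epsilon>\<^sup>2" by blast
qed

text \<open>
By the maximal inequality, for each \<open>\<epsilon>\<close> the event that partial sums started at arbitrarily late times
still oscillate by \<open>\<epsilon>\<close> is null.  Off a countable union of such events the series is Cauchy.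
\<close>

theorem AE_summable:
  assumes sm: "summable (\<lambda>n. \<integral>\<omega>. (X n \<omega>)\<^sup>2 \<partial>M)"
  shows "AE \<omega> in M. summable (\<lambda>n. X n \<omega>)"
proof -
  have small: "AE \<omega> in M. \<exists>m. \<forall>j. \<bar>partial_sum m j \<omega>\<bar> < \<epsilon>" if "0 < \<epsilon>" for \<epsilon>
  proof -
    define N where "N = {\<omega> \<in> space M. \<forall>m. \<exists>j. \<epsilon> \<le> \<bar>partial_sum m j \<omega>\<bar>}"
    have N: "N \<in> sets M" unfolding N_def by measurable
    have "prob N \<le> 0"
    proof (rule LIMSEQ_le_const)
      show "(\<lambda>m. (\<Sum>i. \<integral>\<omega>. (X (i + m) \<omega>)\<^sup>2 \<partial>M) / \<epsilon>\<^sup>2) \<longlonglongrightarrow> 0"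
        using tendsto_divide[OF suminf_exist_split2[OF sm] tendsto_const[of "\<epsilon>\<^sup>2"]] that by simp
      have "prob N \<le> (\<Sum>i. \<integral>\<omega>. (X (i + m) \<omega>)\<^sup>2 \<partial>M) / \<epsilon>\<^sup>2" for m
      proof -
        have "prob N \<le> prob {\<omega> \<in> space M. \<exists>j. \<epsilon> \<le> \<bar>partial_sum m j \<omega>\<bar>}"
          by (rule finite_measure_mono) (auto simp: N_def)
        with tail_maximal_inequality[OF that sm, of m] show ?thesis by linarith
      qed
      then show "\<exists>k. \<forall>m\<ge>k. prob N \<le> (\<Sum>i. \<integral>\<omega>. (X (i + m) \<omega>)\<^sup>2 \<partial>M) / \<epsilon>\<^sup>2" by blast
    qed
    then have "prob N = 0" using measure_nonneg[of M N] by linarith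
    then have "AE \<omega> in M. \<omega> \<notin> N" using N by (simp add: prob_eq_0)
    then show ?thesis by (rule AE_mp) (auto simp: N_def not_le intro!: AE_I2)
  qed
  have "AE \<omega> in M. \<forall>k. \<exists>m. \<forall>j. \<bar>partial_sum m j \<omega>\<bar> < inverse (real (Suc k))"
    unfolding AE_all_countable by (intro allI small) simp
  then show ?thesis
  proof (rule AE_mp, intro AE_I2 impI)
    fix \<omega> assume *: "\<forall>k. \<exists>m. \<forall>j. \<bar>partial_sum m j \<omega>\<bar> < inverse (real (Suc k))"
    have split: "(\<Sum>i<m + j. X i \<omega>) = (\<Sum>i<m. X i \<omega>) + partial_sum m j \<omega>" for m j
      by (induction j) (auto simp: partial_sum_def)
    have "Cauchy (\<lambda>n. \<Sum>i<n. X i \<omega>)"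
      unfolding Cauchy_def
    proof (intro allI impI)
      fix e :: real assume "0 < e"
      then obtain k where k: "inverse (real (Suc k)) < e / 2" using reals_Archimedean[of "e / 2"] by auto
      from * obtain m where m: "\<And>j. \<bar>partial_sum m j \<omega>\<bar> < inverse (real (Suc k))" by blast
      have "dist (\<Sum>i<n. X i \<omega>) (\<Sum>i<n'. X i \<omega>) < e" if "n \<ge> m" "n' \<ge> m" for n n'
      proof -
        have "\<bar>partial_sum m (n - m) \<omega> - partial_sum m (n' - m) \<omega>\<bar> < e"
          using m[of "n - m"] m[of "n' - m"] k by linarith
        then show ?thesis
          using split[of m "n - m"] split[of m "n' - m"] that by (simp add: dist_real_def)
      qed
      then show "\<exists>M. \<forall>m\<ge>M. \<forall>n\<ge>M. dist (\<Sum>i<m. X i \<omega>) (\<Sum>i<n. X i \<omega>) < e" by blast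
    qed
    then show "summable (\<lambda>n. X n \<omega>)"
      by (simp add: summable_iff_convergent Cauchy_convergent_iff)
  qed
qed

end

section \<open>The noise of a Markov decision process\<close>

locale mdp_run = mdp p
  for p :: "'s::finite \<Rightarrow> 'a::finite \<Rightarrow> (real \<times> 's) measure" +
  fixes M :: "'w measure"
    and s :: "nat \<Rightarrow> 'w \<Rightarrow> 's" and a :: "nat \<Rightarrow> 'w \<Rightarrow> 'a" and r :: "nat \<Rightarrow> 'w \<Rightarrow> real"
  assumes process: "mdp_process M p s a r"
begin

sublocale prob_space M
  using process by (simp add: mdp_process_def)

abbreviation outcome_space :: "(real \<times> 's) measure" where
  "outcome_space \<equiv> borel \<Otimes>\<^sub>M count_space UNIV"

abbreviation history :: "nat \<Rightarrow> 'w measure" where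
  "history \<equiv> history_algebra M s a r"

definition outcome :: "nat \<Rightarrow> 'w \<Rightarrow> real \<times> 's" where
  "outcome t \<omega> = (r t \<omega>, s (Suc t) \<omega>)"

lemma measurable_run [measurable]:
  "s t \<in> measurable M (count_space UNIV)" "a t \<in> measurable M (count_space UNIV)"
  "r t \<in> borel_measurable M"
  using process by (auto simp: mdp_process_def)

lemma measurable_outcome [measurable]: "outcome t \<in> measurable M outcome_space"
  unfolding outcome_def[abs_def] by measurable

lemma space_history: "space (history t) = space M"
  by (simp add: history_algebra_def)

lemma history_measurable_state: "s t \<in> measurable (history t) (count_space UNIV)"
  and history_measurable_action: "a t \<in> measurable (history t) (count_space UNIV)"
  and history_measurable_past: "i < t \<Longrightarrow> s i \<in> measurable (history t) (count_space UNIV)"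
    "i < t \<Longrightarrow> a i \<in> measurable (history t) (count_space UNIV)"
    "i < t \<Longrightarrow> r i \<in> borel_measurable (history t)"
proof -
  let ?N = "(\<Pi>\<^sub>M i\<in>{..<t}. count_space UNIV \<Otimes>\<^sub>M count_space UNIV \<Otimes>\<^sub>M borel)
    \<Otimes>\<^sub>M count_space UNIV \<Otimes>\<^sub>M count_space UNIV"
  let ?h = "\<lambda>\<omega>. (\<lambda>i\<in>{..<t}. (s i \<omega>, a i \<omega>, r i \<omega>), s t \<omega>, a t \<omega>)"
  have h: "?h \<in> measurable (history t) ?N"
    unfolding history_algebra_def
    by (rule measurable_vimage_algebra1) (auto simp: space_pair_measure space_PiM)
  show "s t \<in> measurable (history t) (count_space UNIV)"
    "a t \<in> measurable (history t) (count_space UNIV)"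
    using measurable_compose[OF h, of "\<lambda>x. fst (snd x)"] measurable_compose[OF h, of "\<lambda>x. snd (snd x)"]
    by simp_all
  assume i: "i < t"
  have "(\<lambda>x. fst x i) \<in> measurable ?N (count_space UNIV \<Otimes>\<^sub>M count_space UNIV \<Otimes>\<^sub>M borel)"
    using i by (intro measurable_compose[OF measurable_fst measurable_component_singleton]) simp
  from measurable_compose[OF h this]
  have *: "(\<lambda>\<omega>. (s i \<omega>, a i \<omega>, r i \<omega>))
      \<in> measurable (history t) (count_space UNIV \<Otimes>\<^sub>M count_space UNIV \<Otimes>\<^sub>M borel)"
    using i by simp
  show "s i \<in> measurable (history t) (count_space UNIV)"
    "a i \<in> measurable (history t) (count_space UNIV)" "r i \<in> borel_measurable (history t)"
    using measurable_compose[OF *, of fst] measurable_compose[OF *, of "\<lambda>x. fst (snd x)"]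
      measurable_compose[OF *, of "\<lambda>x. snd (snd x)"]
    by simp_all
qed

lemma sets_history_subset:
  assumes "space N = space M"
    and "\<And>i. i \<le> t \<Longrightarrow> s i \<in> measurable N (count_space UNIV)"
    and "\<And>i. i \<le> t \<Longrightarrow> a i \<in> measurable N (count_space UNIV)"
    and "\<And>i. i < t \<Longrightarrow> r i \<in> borel_measurable N"
  shows "sets (history t) \<subseteq> sets N"
  unfolding history_algebra_def
proof (rule sets_image_in_sets)
  show "(\<lambda>\<omega>. (\<lambda>i\<in>{..<t}. (s i \<omega>, a i \<omega>, r i \<omega>), s t \<omega>, a t \<omega>)) \<in> measurable N
      ((\<Pi>\<^sub>M i\<in>{..<t}. count_space UNIV \<Otimes>\<^sub>M count_space UNIV \<Otimes>\<^sub>M borel)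
        \<Otimes>\<^sub>M count_space UNIV \<Otimes>\<^sub>M count_space UNIV)"
    using assms(2-4) by (intro measurable_Pair measurable_restrict) auto
qed (use assms in auto)

lemma subalgebra_history: "subalgebra M (history t)"
  unfolding subalgebra_def using sets_history_subset[of M t] by (simp add: space_history)

lemma history_filtration: "sets (history t) \<subseteq> sets (history (Suc t))"
proof (rule sets_history_subset)
  fix i
  show "i \<le> t \<Longrightarrow> s i \<in> measurable (history (Suc t)) (count_space UNIV)"
    "i \<le> t \<Longrightarrow> a i \<in> measurable (history (Suc t)) (count_space UNIV)"
    "i < t \<Longrightarrow> r i \<in> borel_measurable (history (Suc t))"
    by (auto intro: history_measurable_past)
qed (rule space_history)

lemma measurable_history_Suc:
  "f \<in> measurable (history t) N \<Longrightarrow> f \<in> measurable (history (Suc t)) N"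
  using history_filtration[of t] by (auto simp: measurable_def space_history)

lemma history_measurable_M: "f \<in> measurable (history t) N \<Longrightarrow> f \<in> measurable M N"
  using measurable_from_subalg[OF subalgebra_history] .

lemma finite_measure_subalgebra_history: "finite_measure_subalgebra M (history t)"
  by (intro finite_measure_subalgebra.intro finite_measure_subalgebra_axioms.intro
      finite_measure_axioms subalgebra_history)

definition visit :: "nat \<Rightarrow> 's \<times> 'a \<Rightarrow> 'w set" where
  "visit t x = {\<omega> \<in> space M. (s t \<omega>, a t \<omega>) = x}"

lemma visit_history [measurable]: "visit t x \<in> sets (history t)"
proof -
  note [measurable] = history_measurable_state history_measurable_action
  have "visit t x = {\<omega> \<in> space (history t). s t \<omega> = fst x \<and> a t \<omega> = snd x}"
    by (auto simp: visit_def space_history)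
  also have "\<dots> \<in> sets (history t)" by measurable
  finally show ?thesis .
qed

text \<open>
The Markov property in integrated form: whatever has happened so far, once \<open>x\<close> is visited the outcome
is distributed according to the kernel at \<open>x\<close>.
\<close>

lemma outcome_law:
  assumes G: "G \<in> sets (history t)" "G \<subseteq> visit t x"
  shows "distr (density M (\<lambda>\<omega>. ennreal (indicator G \<omega>))) outcome_space (outcome t)
    = density (p (fst x) (snd x)) (\<lambda>_. ennreal (prob G))"
proof (rule measure_eqI)
  show "sets (distr (density M (\<lambda>\<omega>. ennreal (indicator G \<omega>))) outcome_space (outcome t))
    = sets (density (p (fst x) (snd x)) (\<lambda>_. ennreal (prob G)))"
    by (simp add: sets_p)
next
  interpret H: finite_measure_subalgebra M "history t" by (rule finite_measure_subalgebra_history)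
  interpret p: prob_space "p (fst x) (snd x)" by (rule prob_space_p)
  have [measurable]: "G \<in> sets M" using G(1) subalgebra_history[of t] by (auto simp: subalgebra_def)
  fix B assume "B \<in> sets (distr (density M (\<lambda>\<omega>. ennreal (indicator G \<omega>))) outcome_space (outcome t))"
  then have B [measurable]: "B \<in> sets outcome_space" by simp
  let ?I = "\<lambda>\<omega>. indicator B (outcome t \<omega>) :: real"
  have "AE \<omega> in M. real_cond_exp M (history t) ?I \<omega> = measure (p (s t \<omega>) (a t \<omega>)) B"
    using process B unfolding mdp_process_def outcome_def by blast
  then have law: "AE \<omega> in M. indicator G \<omega> * real_cond_exp M (history t) ?I \<omega>
      = indicator G \<omega> * measure (p (fst x) (snd x)) B"
    by (rule AE_mp) (use G(2) in \<open>auto simp: visit_def indicator_def intro!: AE_I2\<close>)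
  have int: "integrable M (\<lambda>\<omega>. indicator G \<omega> * ?I \<omega>)"
    by (rule integrable_const_bound[where B = 1]) (auto simp: indicator_def)
  have "prob (G \<inter> outcome t -` B \<inter> space M) = (\<integral>\<omega>. indicator G \<omega> * ?I \<omega> \<partial>M)"
  proof -
    have "(\<integral>\<omega>. indicator G \<omega> * ?I \<omega> \<partial>M) = (\<integral>\<omega>. indicator (G \<inter> outcome t -` B \<inter> space M) \<omega> \<partial>M)"
      by (rule Bochner_Integration.integral_cong) (auto simp: indicator_def)
    also have "\<dots> = prob (G \<inter> outcome t -` B \<inter> space M)"
      by (simp add: Int_absorb2 Int_commute)
    finally show ?thesis by simp
  qed
  also have "\<dots> = (\<integral>\<omega>. indicator G \<omega> * real_cond_exp M (history t) ?I \<omega> \<partial>M)"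
    using H.real_cond_exp_intg(2)[OF int] G(1) by simp
  also have "\<dots> = (\<integral>\<omega>. indicator G \<omega> * measure (p (fst x) (snd x)) B \<partial>M)"
    by (rule integral_cong_AE[OF _ _ law]) measurable
  also have "\<dots> = prob G * measure (p (fst x) (snd x)) B"
    by (simp add: Int_absorb1 sets.sets_into_space)
  finally have eq: "prob (G \<inter> outcome t -` B \<inter> space M) = prob G * measure (p (fst x) (snd x)) B" .
  have "emeasure (distr (density M (\<lambda>\<omega>. ennreal (indicator G \<omega>))) outcome_space (outcome t)) B
      = emeasure (density M (indicator G)) (outcome t -` B \<inter> space M)"
    by (subst emeasure_distr) (auto simp: ennreal_indicator)
  also have "\<dots> = emeasure M (G \<inter> outcome t -` B \<inter> space M)"
    by (simp add: emeasure_density Int_assoc flip: indicator_inter_arith)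
  also have "\<dots> = emeasure (density (p (fst x) (snd x)) (\<lambda>_. ennreal (prob G))) B"
    by (simp add: emeasure_eq_measure eq emeasure_density_const sets_p p.emeasure_eq_measure ennreal_mult)
  finally show "emeasure (distr (density M (\<lambda>\<omega>. ennreal (indicator G \<omega>))) outcome_space (outcome t)) B
      = emeasure (density (p (fst x) (snd x)) (\<lambda>_. ennreal (prob G))) B" .
qed

lemma integral_outcome:
  fixes f :: "real \<times> 's \<Rightarrow> real"
  assumes G: "G \<in> sets (history t)" "G \<subseteq> visit t x"
    and f: "integrable (p (fst x) (snd x)) f"
  shows "integrable M (\<lambda>\<omega>. indicator G \<omega> * f (outcome t \<omega>))"
    and "(\<integral>\<omega>. indicator G \<omega> * f (outcome t \<omega>) \<partial>M) = prob G * (\<integral>y. f y \<partial>p (fst x) (snd x))"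
proof -
  have [measurable]: "G \<in> sets M" using G(1) subalgebra_history[of t] by (auto simp: subalgebra_def)
  have f_m: "f \<in> borel_measurable outcome_space"
    using borel_measurable_integrable[OF f] by (simp add: measurable_cong_sets[OF sets_p refl])
  note [measurable] = f_m
  have f_p: "f \<in> borel_measurable (p (fst x) (snd x))" using f by simp
  have "integrable (density (p (fst x) (snd x)) (\<lambda>_. ennreal (prob G))) f"
    using f f_p by (subst integrable_density) auto
  then have "integrable (density M (\<lambda>\<omega>. ennreal (indicator G \<omega>))) (\<lambda>\<omega>. f (outcome t \<omega>))"
    unfolding outcome_law[OF G, symmetric] by (subst (asm) integrable_distr_eq) auto
  then show "integrable M (\<lambda>\<omega>. indicator G \<omega> * f (outcome t \<omega>))"
    by (subst (asm) integrable_density) auto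
  have "(\<integral>\<omega>. indicator G \<omega> * f (outcome t \<omega>) \<partial>M)
      = (\<integral>\<omega>. f (outcome t \<omega>) \<partial>density M (\<lambda>\<omega>. ennreal (indicator G \<omega>)))"
    by (subst integral_density) auto
  also have "\<dots> = (\<integral>y. f y \<partial>density (p (fst x) (snd x)) (\<lambda>_. ennreal (prob G)))"
    unfolding outcome_law[OF G, symmetric] by (subst integral_distr) auto
  also have "\<dots> = prob G * (\<integral>y. f y \<partial>p (fst x) (snd x))"
    using f_p by (subst integral_density) auto
  finally show "(\<integral>\<omega>. indicator G \<omega> * f (outcome t \<omega>) \<partial>M) = prob G * (\<integral>y. f y \<partial>p (fst x) (snd x))" .
qed

definition noise :: "(real \<times> 's \<Rightarrow> real) \<Rightarrow> 's \<times> 'a \<Rightarrow> nat \<Rightarrow> 'w \<Rightarrow> real" where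
  "noise f x t \<omega> = indicator (visit t x) \<omega> * (f (outcome t \<omega>) - (\<integral>y. f y \<partial>p (fst x) (snd x)))"

lemma noise_second_moment:
  assumes "f \<in> borel_measurable outcome_space"
    and f2: "integrable (p (fst x) (snd x)) (\<lambda>y. (f y)\<^sup>2)"
  shows "integrable M (\<lambda>\<omega>. (noise f x t \<omega>)\<^sup>2)"
    and "(\<integral>\<omega>. (noise f x t \<omega>)\<^sup>2 \<partial>M)
      \<le> (\<integral>y. (f y - (\<integral>y. f y \<partial>p (fst x) (snd x)))\<^sup>2 \<partial>p (fst x) (snd x))"
proof -
  interpret p: prob_space "p (fst x) (snd x)" by (rule prob_space_p)
  note [measurable] = assms(1)
  have f1: "integrable (p (fst x) (snd x)) f"
    by (rule p.square_integrable_imp_integrable[OF _ f2]) measurable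
  let ?h = "\<lambda>y. (f y - (\<integral>y. f y \<partial>p (fst x) (snd x)))\<^sup>2"
  have h: "integrable (p (fst x) (snd x)) ?h"
    unfolding power2_diff using f1 f2 by auto
  have sq: "(noise f x t \<omega>)\<^sup>2 = indicator (visit t x) \<omega> * ?h (outcome t \<omega>)" for \<omega>
    by (simp add: noise_def indicator_def)
  note law = integral_outcome[OF visit_history order_refl h]
  show "integrable M (\<lambda>\<omega>. (noise f x t \<omega>)\<^sup>2)" unfolding sq by (rule law(1))
  have "prob (visit t x) * integral\<^sup>L (p (fst x) (snd x)) ?h \<le> 1 * integral\<^sup>L (p (fst x) (snd x)) ?h"
    by (intro mult_right_mono) auto
  then show "(\<integral>\<omega>. (noise f x t \<omega>)\<^sup>2 \<partial>M) \<le> integral\<^sup>L (p (fst x) (snd x)) ?h"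
    unfolding sq law(2) by simp
qed

lemma noise_adapted:
  assumes [measurable]: "f \<in> borel_measurable outcome_space"
  shows "noise f x t \<in> borel_measurable (history (Suc t))"
proof -
  have [measurable]: "r t \<in> borel_measurable (history (Suc t))"
    "s (Suc t) \<in> measurable (history (Suc t)) (count_space UNIV)"
    "visit t x \<in> sets (history (Suc t))"
    using history_measurable_past(3) history_measurable_state history_filtration visit_history by blast+
  show ?thesis unfolding noise_def[abs_def] outcome_def by measurable
qed

text \<open>
The conditional expectation of the noise given the history vanishes, because its integral over every
event of the history does.
\<close>

lemma noise_orthogonal:
  assumes f: "f \<in> borel_measurable outcome_space"
    and f2: "integrable (p (fst x) (snd x)) (\<lambda>y. (f y)\<^sup>2)"
    and g: "g \<in> borel_measurable (history t)" "integrable M (\<lambda>\<omega>. (g \<omega>)\<^sup>2)"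
  shows "(\<integral>\<omega>. g \<omega> * noise f x t \<omega> \<partial>M) = 0"
proof -
  interpret H: finite_measure_subalgebra M "history t" by (rule finite_measure_subalgebra_history)
  interpret p: prob_space "p (fst x) (snd x)" by (rule prob_space_p)
  note [measurable] = f
  have f1: "integrable (p (fst x) (snd x)) f"
    by (rule p.square_integrable_imp_integrable[OF _ f2]) measurable
  let ?c = "\<integral>y. f y \<partial>p (fst x) (snd x)"
  have noise_m [measurable]: "noise f x t \<in> borel_measurable M"
    using history_measurable_M[OF noise_adapted[OF f]] .
  have int: "integrable M (noise f x t)"
    by (rule square_integrable_imp_integrable[OF noise_m noise_second_moment(1)[OF f f2]])
  have "AE \<omega> in M. real_cond_exp M (history t) (noise f x t) \<omega> = 0"
  proof (rule H.real_cond_exp_charact[where g = "\<lambda>_. 0"])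
    fix G assume G: "G \<in> sets (history t)"
    let ?G = "G \<inter> visit t x"
    have G': "?G \<in> sets (history t)" "?G \<subseteq> visit t x" using G visit_history by auto
    have "(\<integral>\<omega>\<in>G. noise f x t \<omega> \<partial>M) = (\<integral>\<omega>. indicator ?G \<omega> * (f (outcome t \<omega>) - ?c) \<partial>M)"
      unfolding set_lebesgue_integral_def
      by (rule Bochner_Integration.integral_cong) (auto simp: noise_def indicator_def)
    also have "\<dots> = prob ?G * (\<integral>y. f y - ?c \<partial>p (fst x) (snd x))"
      by (rule integral_outcome(2)[OF G']) (use f1 in auto)
    also have "(\<integral>y. f y - ?c \<partial>p (fst x) (snd x)) = 0"
      using f1 by (simp add: p.prob_space)
    finally show "(\<integral>\<omega>\<in>G. noise f x t \<omega> \<partial>M) = (\<integral>\<omega>\<in>G. 0 \<partial>M)" by simp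
  qed (use int in auto)
  moreover have "integrable M (\<lambda>\<omega>. g \<omega> * noise f x t \<omega>)"
    using history_measurable_M[OF g(1)] g(2) noise_second_moment(1)[OF f f2]
    by (intro integrable_product_of_squares) auto
  then have "(\<integral>\<omega>. g \<omega> * noise f x t \<omega> \<partial>M)
      = (\<integral>\<omega>. g \<omega> * real_cond_exp M (history t) (noise f x t) \<omega> \<partial>M)"
    using H.real_cond_exp_intg(2) g(1) by simp
  moreover have "\<dots> = (\<integral>\<omega>. 0 \<partial>M)"
    by (rule integral_cong_AE)
      (use history_measurable_M[OF g(1)] \<open>AE \<omega> in M. _ \<omega> = 0\<close> in auto)
  ultimately show ?thesis by simp
qed

text \<open>
The weights \<open>u\<close> are known before the outcome is drawn, so the weighted noise is again a sequence of
martingale differences; its second moments are dominated by a multiple of \<open>(c t)\<^sup>2\<close>.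
\<close>

theorem AE_summable_weighted_noise:
  fixes c :: "nat \<Rightarrow> real" and u :: "nat \<Rightarrow> 'w \<Rightarrow> real"
  assumes f: "f \<in> borel_measurable outcome_space"
    and f2: "integrable (p (fst x) (snd x)) (\<lambda>y. (f y)\<^sup>2)"
    and c: "summable (\<lambda>t. (c t)\<^sup>2)"
    and u: "\<And>t. u t \<in> borel_measurable (history t)" "\<And>t \<omega>. \<bar>u t \<omega>\<bar> \<le> K"
  shows "AE \<omega> in M. summable (\<lambda>t. c t * (u t \<omega> * noise f x t \<omega>))"
proof -
  define X where "X t \<omega> = c t * (u t \<omega> * noise f x t \<omega>)" for t \<omega>
  define D where "D = (\<integral>y. (f y - (\<integral>y. f y \<partial>p (fst x) (snd x)))\<^sup>2 \<partial>p (fst x) (snd x))"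
  have [measurable]: "noise f x t \<in> borel_measurable M" "u t \<in> borel_measurable M" for t
    using history_measurable_M noise_adapted[OF f] u(1) by blast+
  have u2: "(u t \<omega>)\<^sup>2 \<le> K\<^sup>2" for t \<omega>
    using u(2)[of t \<omega>] by (simp add: abs_le_square_iff[symmetric])
  then have X2_le: "(X t \<omega>)\<^sup>2 \<le> (c t)\<^sup>2 * K\<^sup>2 * (noise f x t \<omega>)\<^sup>2" for t \<omega>
    unfolding X_def power_mult_distrib mult.assoc by (intro mult_left_mono mult_right_mono) auto
  have X2: "integrable M (\<lambda>\<omega>. (X t \<omega>)\<^sup>2)" for t
  proof (rule Bochner_Integration.integrable_bound)
    show "integrable M (\<lambda>\<omega>. (c t)\<^sup>2 * K\<^sup>2 * (noise f x t \<omega>)\<^sup>2)"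
      using noise_second_moment(1)[OF f f2] by simp
  qed (use X2_le in \<open>auto simp: X_def\<close>)
  interpret martingale_differences M history X
  proof
    fix t
    show "subalgebra M (history t)" "sets (history t) \<subseteq> sets (history (Suc t))"
      by (rule subalgebra_history history_filtration)+
    show "X t \<in> borel_measurable (history (Suc t))"
      unfolding X_def using noise_adapted[OF f] measurable_history_Suc[OF u(1)] by measurable
    show "integrable M (\<lambda>\<omega>. (X t \<omega>)\<^sup>2)" by (rule X2)
    fix g :: "'w \<Rightarrow> real" assume g: "g \<in> borel_measurable (history t)" "integrable M (\<lambda>\<omega>. (g \<omega>)\<^sup>2)"
    have [measurable]: "g \<in> borel_measurable M" using history_measurable_M[OF g(1)] .
    have "(\<integral>\<omega>. (c t * g \<omega> * u t \<omega>) * noise f x t \<omega> \<partial>M) = 0"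
    proof (rule noise_orthogonal[OF f f2])
      show "(\<lambda>\<omega>. c t * g \<omega> * u t \<omega>) \<in> borel_measurable (history t)" using g(1) u(1) by measurable
      show "integrable M (\<lambda>\<omega>. (c t * g \<omega> * u t \<omega>)\<^sup>2)"
      proof (rule Bochner_Integration.integrable_bound)
        show "integrable M (\<lambda>\<omega>. (c t)\<^sup>2 * K\<^sup>2 * (g \<omega>)\<^sup>2)" using g(2) by simp
        have "(c t * g \<omega> * u t \<omega>)\<^sup>2 \<le> (c t)\<^sup>2 * K\<^sup>2 * (g \<omega>)\<^sup>2" for \<omega>
          using mult_left_mono[OF u2[of t \<omega>], of "(c t * g \<omega>)\<^sup>2"]
          by (simp add: power_mult_distrib mult_ac)
        then show "AE \<omega> in M. norm ((c t * g \<omega> * u t \<omega>)\<^sup>2) \<le> norm ((c t)\<^sup>2 * K\<^sup>2 * (g \<omega>)\<^sup>2)" by simp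
      qed measurable
    qed
    then show "(\<integral>\<omega>. g \<omega> * X t \<omega> \<partial>M) = 0" by (simp add: X_def mult_ac)
  qed
  have "summable (\<lambda>t. \<integral>\<omega>. (X t \<omega>)\<^sup>2 \<partial>M)"
  proof (rule summable_comparison_test'[where N = 0])
    show "summable (\<lambda>t. (c t)\<^sup>2 * (K\<^sup>2 * D))" using c by (rule summable_mult2)
    fix t
    have "(\<integral>\<omega>. (X t \<omega>)\<^sup>2 \<partial>M) \<le> (\<integral>\<omega>. (c t)\<^sup>2 * K\<^sup>2 * (noise f x t \<omega>)\<^sup>2 \<partial>M)"
      using noise_second_moment(1)[OF f f2] by (intro integral_mono X2 X2_le) auto
    also have "\<dots> \<le> (c t)\<^sup>2 * K\<^sup>2 * D"
      using noise_second_moment(2)[OF f f2] by (simp add: D_def mult_left_mono)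
    finally show "norm (\<integral>\<omega>. (X t \<omega>)\<^sup>2 \<partial>M) \<le> (c t)\<^sup>2 * (K\<^sup>2 * D)" by (simp add: mult.assoc)
  qed
  from AE_summable[OF this] show ?thesis by (simp add: X_def)
qed

text \<open>
The iterate at time \<open>k\<close> uses the states up to time \<open>k\<close> but only the actions and rewards before it,
which is why it belongs to the history at time \<open>k\<close>.
\<close>

lemma Q_learning_history_measurable:
  "k \<le> t \<Longrightarrow> (\<lambda>\<omega>. Q_learning c \<gamma> Q0 (\<lambda>i. s i \<omega>) (\<lambda>i. a i \<omega>) (\<lambda>i. r i \<omega>) k x)
    \<in> borel_measurable (history t)"
proof (induction k arbitrary: x)
  case (Suc k)
  let ?Q = "\<lambda>\<omega>. Q_learning c \<gamma> Q0 (\<lambda>i. s i \<omega>) (\<lambda>i. a i \<omega>) (\<lambda>i. r i \<omega>) k"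
  have [measurable]: "(\<lambda>\<omega>. ?Q \<omega> x) \<in> borel_measurable (history t)" for x using Suc by simp
  have [measurable]: "s k \<in> measurable (history t) (count_space UNIV)"
    "a k \<in> measurable (history t) (count_space UNIV)" "r k \<in> borel_measurable (history t)"
    using Suc.prems by (auto intro: history_measurable_past)
  have [measurable]: "s (Suc k) \<in> measurable (history t) (count_space UNIV)"
    using Suc.prems history_measurable_past(1) history_measurable_state by (cases "Suc k = t") auto
  have [measurable]: "(\<lambda>\<omega>. ?Q \<omega> (s (Suc k) \<omega>, b)) \<in> borel_measurable (history t)" for b
    by (rule measurable_compose_countable[where f = "\<lambda>z \<omega>. ?Q \<omega> (z, b)"]) measurable
  have "(\<lambda>\<omega>. MAX b. ?Q \<omega> (s (Suc k) \<omega>, b)) \<in> borel_measurable (history t)"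
    by (rule borel_measurable_Max) simp_all
  note [measurable] = this
  have "(\<lambda>\<omega>. learning_rate c x (s k \<omega>) (a k \<omega>) k)
      = (\<lambda>\<omega>. if s k \<omega> = fst x \<and> a k \<omega> = snd x then c k else 0)"
    by (auto simp: learning_rate_def fun_eq_iff)
  also have "\<dots> \<in> borel_measurable (history t)" by measurable
  finally have [measurable]: "(\<lambda>\<omega>. learning_rate c x (s k \<omega>) (a k \<omega>) k) \<in> borel_measurable (history t)" .
  show ?case by simp
qed simp

section \<open>Almost sure convergence\<close>

text \<open>
A realization visits \<open>x\<close> exactly when the learning rate of \<open>x\<close> can be nonzero, so the weighted
noise is the noise term of the iteration.
\<close>

lemma noise_eq:
  assumes "\<omega> \<in> space M"
  shows "c t * (u * noise f x t \<omega>)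
    = learning_rate c x (s t \<omega>) (a t \<omega>) t * (u * (f (outcome t \<omega>) - (\<integral>y. f y \<partial>p (fst x) (snd x))))"
  using assms by (simp add: noise_def visit_def learning_rate_def indicator_def)

lemma AE_summable_reward_noise:
  assumes second_moment: "\<And>x y. integrable (p x y) (\<lambda>v. (fst v)\<^sup>2)"
    and c: "summable (\<lambda>t. (c t)\<^sup>2)"
  shows "AE \<omega> in M. summable (\<lambda>t. learning_rate c x (s t \<omega>) (a t \<omega>) t * (r t \<omega> - expected_reward p x))"
proof -
  have "AE \<omega> in M. summable (\<lambda>t. c t * (1 * noise fst x t \<omega>))"
    by (rule AE_summable_weighted_noise[OF _ second_moment c, where K = 1]) auto
  then show ?thesis
    by (rule AE_mp) (auto intro!: AE_I2 simp: noise_eq[where u = 1, simplified] outcome_def expected_reward_def)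
qed

lemma AE_summable_transition_noise:
  assumes c: "summable (\<lambda>t. (c t)\<^sup>2)"
  shows "AE \<omega> in M. summable (\<lambda>t. learning_rate c x (s t \<omega>) (a t \<omega>) t *
    (clip (real K) (MAX b. Q_learning c \<gamma> Q0 (\<lambda>i. s i \<omega>) (\<lambda>i. a i \<omega>) (\<lambda>i. r i \<omega>) t (z, b))
      * (indicator {z} (s (Suc t) \<omega>) - transition_prob p x z)))"
proof -
  let ?f = "indicator (UNIV \<times> {z}) :: real \<times> 's \<Rightarrow> real"
  let ?u = "\<lambda>t \<omega>. clip (real K) (MAX b. Q_learning c \<gamma> Q0 (\<lambda>i. s i \<omega>) (\<lambda>i. a i \<omega>) (\<lambda>i. r i \<omega>) t (z, b))"
  interpret p: prob_space "p (fst x) (snd x)" by (rule prob_space_p)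
  have f [measurable]: "?f \<in> borel_measurable outcome_space"
    by (intro borel_measurable_indicator pair_measureI) auto
  have f2: "integrable (p (fst x) (snd x)) (\<lambda>v. (?f v)\<^sup>2)"
    by (rule p.integrable_const_bound[where B = 1]) (auto simp: indicator_def)
  have u: "?u t \<in> borel_measurable (history t)" for t
  proof -
    have "(\<lambda>\<omega>. MAX b. Q_learning c \<gamma> Q0 (\<lambda>i. s i \<omega>) (\<lambda>i. a i \<omega>) (\<lambda>i. r i \<omega>) t (z, b))
        \<in> borel_measurable (history t)"
      by (intro borel_measurable_Max Q_learning_history_measurable) auto
    then show ?thesis unfolding clip_def by measurable
  qed
  have mean: "(\<integral>v. ?f v \<partial>p (fst x) (snd x)) = transition_prob p x z"
    by (simp add: transition_prob_def space_p)
  have next_state: "?f (outcome t \<omega>) = indicator {z} (s (Suc t) \<omega>)" for t \<omega>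
    by (simp add: outcome_def indicator_def)
  have "AE \<omega> in M. summable (\<lambda>t. c t * (?u t \<omega> * noise ?f x t \<omega>))"
    by (rule AE_summable_weighted_noise[OF f f2 c, where K = "real K"]) (simp_all add: u abs_clip_le)
  then show ?thesis
  proof (rule AE_mp, intro AE_I2 impI)
    fix \<omega> assume "\<omega> \<in> space M" "summable (\<lambda>t. c t * (?u t \<omega> * noise ?f x t \<omega>))"
    then show "summable (\<lambda>t. learning_rate c x (s t \<omega>) (a t \<omega>) t *
        (?u t \<omega> * (indicator {z} (s (Suc t) \<omega>) - transition_prob p x z)))"
      by (simp only: noise_eq mean next_state)
  qed
qed

text \<open>
There are finitely many state-action pairs and next states and countably many truncation levels, so
almost every realization satisfies all hypotheses of the deterministic half at once.
\<close>

theorem AE_Q_learning_tendsto_Q_star: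
  assumes \<gamma>: "0 < \<gamma>" "\<gamma> < 1"
    and second_moment: "\<And>x y. integrable (p x y) (\<lambda>v. (fst v)\<^sup>2)"
    and c: "\<And>t. c t \<in> {0..1}" "summable (\<lambda>t. (c t)\<^sup>2)"
    and rate_sum: "\<And>x. AE \<omega> in M.
          filterlim (\<lambda>n. \<Sum>t<n. learning_rate c x (s t \<omega>) (a t \<omega>) t) at_top sequentially"
  shows "AE \<omega> in M.
    (\<lambda>t. W_norm (\<lambda>x. Q_learning c \<gamma> Q0 (\<lambda>i. s i \<omega>) (\<lambda>i. a i \<omega>) (\<lambda>i. r i \<omega>) t x
                      - Q_star p \<gamma> x)) \<longlonglongrightarrow> 0"
proof -
  have "AE \<omega> in M. \<forall>x. filterlim (\<lambda>n. \<Sum>t<n. learning_rate c x (s t \<omega>) (a t \<omega>) t) at_top sequentially"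
    unfolding AE_all_countable using rate_sum by blast
  moreover have "AE \<omega> in M. \<forall>x. summable (\<lambda>t. learning_rate c x (s t \<omega>) (a t \<omega>) t
      * (r t \<omega> - expected_reward p x))"
    unfolding AE_all_countable using AE_summable_reward_noise[OF second_moment c(2)] by blast
  moreover have "AE \<omega> in M. \<forall>x z K. summable (\<lambda>t. learning_rate c x (s t \<omega>) (a t \<omega>) t *
      (clip (real K) (MAX b. Q_learning c \<gamma> Q0 (\<lambda>i. s i \<omega>) (\<lambda>i. a i \<omega>) (\<lambda>i. r i \<omega>) t (z, b))
        * (indicator {z} (s (Suc t) \<omega>) - transition_prob p x z)))"
    unfolding AE_all_countable using AE_summable_transition_noise[OF c(2)] by blast
  ultimately show ?thesis
  proof eventually_elim
    case (elim \<omega>)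
    show ?case
    proof (rule Q_learning_tendsto_of_noise_summable[where R = "expected_reward p" and P = "transition_prob p"])
      show "bellman (expected_reward p) (transition_prob p) \<gamma> (Q_star p \<gamma>) = Q_star p \<gamma>"
        by (rule Q_star_Bellman[OF \<gamma>])
    qed (use \<gamma> c(1) elim transition_prob_nonneg sum_transition_prob in auto)
  qed
qed

end

theorem theorem1:
  fixes M :: "'w measure"
    and p :: "'s::finite \<Rightarrow> 'a::finite \<Rightarrow> (real \<times> 's) measure"
    and s :: "nat \<Rightarrow> 'w \<Rightarrow> 's" and a :: "nat \<Rightarrow> 'w \<Rightarrow> 'a" and r :: "nat \<Rightarrow> 'w \<Rightarrow> real"
    and \<gamma> :: real and c :: "nat \<Rightarrow> real" and Q0 :: "'s \<times> 'a \<Rightarrow> real"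
  assumes kernel: "transition_kernel p"
    and discount: "0 < \<gamma>" "\<gamma> < 1"
    and second_moment: "\<And>x y. integrable (reward_law p x y) (\<lambda>\<rho>. \<rho>\<^sup>2)"
    and process: "mdp_process M p s a r"
    and c_range: "\<And>t. c t \<in> {0..1}"
    and c_sum: "filterlim (\<lambda>n. \<Sum>t<n. c t) at_top sequentially"
    and c_square_sum: "summable (\<lambda>t. (c t)\<^sup>2)"
    and rate_sum: "\<And>x. AE \<omega> in M.
          filterlim (\<lambda>n. \<Sum>t<n. learning_rate c x (s t \<omega>) (a t \<omega>) t) at_top sequentially"
    and rate_square_sum: "\<And>x. AE \<omega> in M.
          summable (\<lambda>t. (learning_rate c x (s t \<omega>) (a t \<omega>) t)\<^sup>2)"
  shows "AE \<omega> in M.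
    (\<lambda>t. W_norm (\<lambda>x. Q_learning c \<gamma> Q0 (\<lambda>i. s i \<omega>) (\<lambda>i. a i \<omega>) (\<lambda>i. r i \<omega>) t x
                      - Q_star p \<gamma> x)) \<longlonglongrightarrow> 0"
proof -
  have sets_p: "sets (p x y) = sets (borel \<Otimes>\<^sub>M count_space UNIV)" and prob_p: "prob_space (p x y)" for x y
    using kernel by (auto simp: transition_kernel_def space_prob_algebra)
  have fst_m: "fst \<in> borel_measurable (p x y)" for x y
    by (simp add: measurable_cong_sets[OF sets_p refl])
  have square: "integrable (p x y) (\<lambda>v. (fst v)\<^sup>2)" for x y
    using second_moment[of x y] unfolding reward_law_def
    by (subst (asm) integrable_distr_eq) (auto intro: fst_m)
  have "integrable (p x y) fst" for x y
    by (rule finite_measure.square_integrable_imp_integrable[OF _ fst_m square])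
      (rule prob_space.finite_measure[OF prob_p])
  then interpret mdp_run p M s a r
    by unfold_locales (use kernel process in auto)
  show ?thesis
    by (rule AE_Q_learning_tendsto_Q_star[OF discount square c_range c_square_sum rate_sum])
qed

end
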